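(* Let $(\widetilde M,\widetilde g,\widetilde\nabla,\widetilde\nabla^{*},\Theta)$ be a $\Theta$-statistical manifold and let $M\hookrightarrow\widetilde M$ be an isometrically immersed submanifold. For every $X,Y\in\Gamma(TM)$, \begin{align*} \nabla_X(P_{\Theta}Y)-A_{F_{\Theta}Y}X&=P_{\Theta}(\nabla_X^{*}Y)+t_{\Theta}(h^{*}(X,Y)),\\ h(X,P_{\Theta}Y)+\nabla_X^{\perp}(F_{\Theta}Y)&=F_{\Theta}(\nabla_X^{*}Y)+f_{\Theta}(h^{*}(X,Y)). \end{align*}
   Context: A statistical manifold $(\widetilde M,\widetilde g,\widetilde\nabla,\widetilde\nabla^{*})$ is a Riemannian manifold $(\widetilde M,\widetilde g)$ with two torsion-free affine connections dual with respect to $\widetilde g$: $X\widetilde g(Y,Z)=\widetilde g(\widetilde\nabla_XY,Z)+\widetilde g(Y,\widetilde\nabla_X^{*}Z)$. It is a $\Theta$-statistical manifold if it is endowed with a nonzero $(1,1)$-tensor field $\Theta$ satisfying the gauge equation $\widetilde\nabla_X(\Theta Y)=\Theta(\widetilde\nabla_X^{*}Y)$ for all vector fields $X,Y$. For $X,Y\in\Gamma(TM)$ and $\nu\in\Gamma(T^{\perp}M)$, the statistical Gauss--Weingarten formulas (splitting into tangential and normal parts) are \[ \widetilde\nabla_XY=\nabla_XY+h(X,Y),\quad \widetilde\nabla^{*}_XY=\nabla^{*}_XY+h^{*}(X,Y),\quad \widetilde\nabla_X\nu=-A_{\nu}X+\nabla^{\perp}_X\nu, \] which define the induced connections $\nabla,\nabla^{*}$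 on $M$, the second fundamental forms $h,h^{*}$, the shape operator $A_\nu$ and the normal connection $\nabla^{\perp}$. Along $M$, write $\Theta Y=P_{\Theta}Y+F_{\Theta}Y$ for $Y\in\Gamma(TM)$, with $P_{\Theta}Y\in\Gamma(TM)$, $F_{\Theta}Y\in\Gamma(T^{\perp}M)$, and $\Theta\nu=t_{\Theta}\nu+f_{\Theta}\nu$ for $\nu\in\Gamma(T^{\perp}M)$, with $t_{\Theta}\nu\in\Gamma(TM)$, $f_{\Theta}\nu\in\Gamma(T^{\perp}M)$. *)

theory Defs
  imports "HOL-Analysis.Analysis"
begin

section \<open>Smooth functions on open subsets of a normed space\<close>

primrec Ck_on :: "nat \<Rightarrow> 'a::real_normed_vector set \<Rightarrow> ('a \<Rightarrow> 'b::real_normed_vector) \<Rightarrow> bool" where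
  "Ck_on 0 S f \<longleftrightarrow> continuous_on S f"
| "Ck_on (Suc k) S f \<longleftrightarrow>
     (\<forall>x\<in>S. f differentiable (at x)) \<and> (\<forall>v. Ck_on k S (\<lambda>x. frechet_derivative f (at x) v))"

text \<open>Only used for open sets.\<close>

definition smooth_on :: "'a::real_normed_vector set \<Rightarrow> ('a \<Rightarrow> 'b::real_normed_vector) \<Rightarrow> bool" where
  "smooth_on S f \<longleftrightarrow> (\<forall>k. Ck_on k S f)"


section \<open>Smooth manifolds\<close>

text \<open>
  The underlying space of a manifold is a whole type with a Hausdorff, second countable topology;
  the smooth structure is given by an atlas, which need not be maximal. A chart is a pair of its
  domain and its coordinate map; the values of the coordinate map outside the domain are irrelevant.
\<close>

type_synonym ('m, 'e) chart = "'m set \<times> ('m \<Rightarrow> 'e)"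

definition cinv :: "('m, 'e) chart \<Rightarrow> 'e \<Rightarrow> 'm" where
  "cinv c = inv_into (fst c) (snd c)"

definition cimage :: "('m, 'e) chart \<Rightarrow> 'e set" where
  "cimage c = snd c ` fst c"

definition is_chart :: "('m::topological_space, 'e::euclidean_space) chart \<Rightarrow> bool" where
  "is_chart c \<longleftrightarrow>
     open (fst c) \<and> open (cimage c) \<and> homeomorphism (fst c) (cimage c) (snd c) (cinv c)"

locale smooth_manifold =
  fixes A :: "('m::{t2_space, second_countable_topology}, 'e::euclidean_space) chart set"
  assumes charts: "c \<in> A \<Longrightarrow> is_chart c"
    and cover: "(\<Union>c\<in>A. fst c) = UNIV"
    and compatible: "\<lbrakk>c \<in> A; d \<in> A\<rbrakk> \<Longrightarrow> smooth_on (snd c ` (fst c \<inter> fst d)) (snd d \<circ> cinv c)"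

text \<open>
  Every point carries a chosen chart of the atlas around it, and the tangent space at the point is
  the model space, a vector being represented by its coordinates in the chosen chart. A vector field
  is then a function from points to the model space, and everything that compares different points
  (smoothness in particular) goes through the coordinates \<open>tcoord\<close> in a fixed chart.
\<close>

definition chart_at :: "('m, 'e) chart set \<Rightarrow> 'm \<Rightarrow> ('m, 'e) chart" where
  "chart_at A p = (SOME c. c \<in> A \<and> p \<in> fst c)"

text \<open>The coordinates, in the chart \<open>c\<close>, of the tangent vector \<open>v\<close> at \<open>p\<close>.\<close>

definition tcoord ::
  "('m, 'e::euclidean_space) chart set \<Rightarrow> ('m, 'e) chart \<Rightarrow> 'm \<Rightarrow> 'e \<Rightarrow> 'e" where
  "tcoord A c p v =
     frechet_derivative (snd c \<circ> cinv (chart_at A p)) (at (snd (chart_at A p) p)) v"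

definition field_in_chart ::
  "('m, 'e::euclidean_space) chart set \<Rightarrow> ('m, 'e) chart \<Rightarrow> ('m \<Rightarrow> 'e) \<Rightarrow> 'e \<Rightarrow> 'e" where
  "field_in_chart A c X = (\<lambda>x. tcoord A c (cinv c x) (X (cinv c x)))"

definition smooth_fun :: "('m, 'e::euclidean_space) chart set \<Rightarrow> ('m \<Rightarrow> real) \<Rightarrow> bool" where
  "smooth_fun A f \<longleftrightarrow> (\<forall>c\<in>A. smooth_on (cimage c) (f \<circ> cinv c))"

definition vector_fields :: "('m, 'e::euclidean_space) chart set \<Rightarrow> ('m \<Rightarrow> 'e) set" where
  "vector_fields A = {X. \<forall>c\<in>A. smooth_on (cimage c) (field_in_chart A c X)}"

definition dir_deriv ::
  "('m, 'e::euclidean_space) chart set \<Rightarrow> ('m \<Rightarrow> 'e) \<Rightarrow> ('m \<Rightarrow> real) \<Rightarrow> 'm \<Rightarrow> real" where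
  "dir_deriv A X f = (\<lambda>p.
     frechet_derivative (f \<circ> cinv (chart_at A p)) (at (snd (chart_at A p) p)) (X p))"

definition lie_bracket ::
  "('m, 'e::euclidean_space) chart set \<Rightarrow> ('m \<Rightarrow> 'e) \<Rightarrow> ('m \<Rightarrow> 'e) \<Rightarrow> 'm \<Rightarrow> 'e" where
  "lie_bracket A X Y = (\<lambda>p. let c = chart_at A p in
     frechet_derivative (field_in_chart A c Y) (at (snd c p)) (X p)
     - frechet_derivative (field_in_chart A c X) (at (snd c p)) (Y p))"

definition smooth_map ::
  "('n::topological_space, 'd::euclidean_space) chart set \<Rightarrow>
   ('m::topological_space, 'e::euclidean_space) chart set \<Rightarrow> ('n \<Rightarrow> 'm) \<Rightarrow> bool" where
  "smooth_map B A \<iota> \<longleftrightarrow> continuous_on UNIV \<iota> \<and>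
     (\<forall>c\<in>B. \<forall>d\<in>A. smooth_on (snd c ` (fst c \<inter> \<iota> -` fst d)) (snd d \<circ> \<iota> \<circ> cinv c))"

definition differential ::
  "('n, 'd::euclidean_space) chart set \<Rightarrow> ('m, 'e::euclidean_space) chart set \<Rightarrow>
   ('n \<Rightarrow> 'm) \<Rightarrow> 'n \<Rightarrow> 'd \<Rightarrow> 'e" where
  "differential B A \<iota> q v =
     frechet_derivative (snd (chart_at A (\<iota> q)) \<circ> \<iota> \<circ> cinv (chart_at B q))
       (at (snd (chart_at B q) q)) v"


section \<open>Riemannian and statistical manifolds\<close>

locale riemannian_manifold = smooth_manifold A
  for A :: "('m::{t2_space, second_countable_topology}, 'e::euclidean_space) chart set" +
  fixes g :: "'m \<Rightarrow> 'e \<Rightarrow> 'e \<Rightarrow> real"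
  assumes metric_bilinear: "bilinear (g p)"
    and metric_sym: "g p u v = g p v u"
    and metric_pos: "v \<noteq> 0 \<Longrightarrow> g p v v > 0"
    and metric_smooth: "\<lbrakk>X \<in> vector_fields A; Y \<in> vector_fields A\<rbrakk> \<Longrightarrow>
          smooth_fun A (\<lambda>p. g p (X p) (Y p))"

text \<open>
  An affine connection is an operator on pairs of functions, of which only the values on smooth
  vector fields are meaningful. Real homogeneity in the second argument is the Leibniz rule for a
  constant function.
\<close>

locale affine_connection = smooth_manifold A
  for A :: "('m::{t2_space, second_countable_topology}, 'e::euclidean_space) chart set" +
  fixes nab :: "('m \<Rightarrow> 'e) \<Rightarrow> ('m \<Rightarrow> 'e) \<Rightarrow> 'm \<Rightarrow> 'e"
  assumes conn_field:
      "\<lbrakk>X \<in> vector_fields A; Y \<in> vector_fields A\<rbrakk> \<Longrightarrow> nab X Y \<in> vector_fields A"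
    and conn_add_left:
      "\<lbrakk>X \<in> vector_fields A; X' \<in> vector_fields A; Y \<in> vector_fields A\<rbrakk> \<Longrightarrow>
         nab (\<lambda>p. X p + X' p) Y = (\<lambda>p. nab X Y p + nab X' Y p)"
    and conn_scale_left:
      "\<lbrakk>smooth_fun A f; X \<in> vector_fields A; Y \<in> vector_fields A\<rbrakk> \<Longrightarrow>
         nab (\<lambda>p. f p *\<^sub>R X p) Y = (\<lambda>p. f p *\<^sub>R nab X Y p)"
    and conn_add_right:
      "\<lbrakk>X \<in> vector_fields A; Y \<in> vector_fields A; Y' \<in> vector_fields A\<rbrakk> \<Longrightarrow>
         nab X (\<lambda>p. Y p + Y' p) = (\<lambda>p. nab X Y p + nab X Y' p)"
    and conn_leibniz:
      "\<lbrakk>smooth_fun A f; X \<in> vector_fields A; Y \<in> vector_fields A\<rbrakk> \<Longrightarrow>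
         nab X (\<lambda>p. f p *\<^sub>R Y p) = (\<lambda>p. dir_deriv A X f p *\<^sub>R Y p + f p *\<^sub>R nab X Y p)"

locale torsion_free_connection = affine_connection A nab
  for A :: "('m::{t2_space, second_countable_topology}, 'e::euclidean_space) chart set" and nab +
  assumes torsion_free:
    "\<lbrakk>X \<in> vector_fields A; Y \<in> vector_fields A\<rbrakk> \<Longrightarrow>
       (\<lambda>p. nab X Y p - nab Y X p) = lie_bracket A X Y"

locale statistical_manifold =
  riemannian_manifold A g + conn: torsion_free_connection A nab + dual: torsion_free_connection A nab'
  for A :: "('m::{t2_space, second_countable_topology}, 'e::euclidean_space) chart set"
    and g nab nab' +
  assumes dual_connections:
    "\<lbrakk>X \<in> vector_fields A; Y \<in> vector_fields A; Z \<in> vector_fields A\<rbrakk> \<Longrightarrow>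
       dir_deriv A X (\<lambda>p. g p (Y p) (Z p))
         = (\<lambda>p. g p (nab X Y p) (Z p) + g p (Y p) (nab' X Z p))"

locale theta_statistical_manifold = statistical_manifold A g nab nab'
  for A :: "('m::{t2_space, second_countable_topology}, 'e::euclidean_space) chart set"
    and g nab nab' +
  fixes \<Theta> :: "'m \<Rightarrow> 'e \<Rightarrow> 'e"
  assumes theta_linear: "linear (\<Theta> p)"
    and theta_smooth: "Y \<in> vector_fields A \<Longrightarrow> (\<lambda>p. \<Theta> p (Y p)) \<in> vector_fields A"
    and theta_nonzero: "\<exists>p v. \<Theta> p v \<noteq> 0"
    and gauge: "\<lbrakk>X \<in> vector_fields A; Y \<in> vector_fields A\<rbrakk> \<Longrightarrow>
          nab X (\<lambda>p. \<Theta> p (Y p)) = (\<lambda>p. \<Theta> p (nab' X Y p))"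


section \<open>Isometrically immersed submanifolds\<close>

locale isometric_immersion =
  sub: riemannian_manifold B gM + ambient: riemannian_manifold A g
  for B :: "('n::{t2_space, second_countable_topology}, 'd::euclidean_space) chart set"
    and gM
    and A :: "('m::{t2_space, second_countable_topology}, 'e::euclidean_space) chart set"
    and g +
  fixes \<iota> :: "'n \<Rightarrow> 'm"
  assumes immersion_smooth: "smooth_map B A \<iota>"
    and immersion_inj: "inj (differential B A \<iota> q)"
    and isometric:
      "gM q u v = g (\<iota> q) (differential B A \<iota> q u) (differential B A \<iota> q v)"

text \<open>
  A vector \<open>w\<close> of the ambient tangent space at \<open>\<iota> q\<close> splits orthogonally into a vector in the image of
  the differential and a normal vector. Tangential parts are returned as vectors of the tangent space
  of the submanifold itself, that is, before applying the differential.
\<close>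

definition tan_part ::
  "('m, 'e::euclidean_space) chart set \<Rightarrow> ('m \<Rightarrow> 'e \<Rightarrow> 'e \<Rightarrow> real) \<Rightarrow>
   ('n, 'd::euclidean_space) chart set \<Rightarrow> ('n \<Rightarrow> 'm) \<Rightarrow> 'n \<Rightarrow> 'e \<Rightarrow> 'd" where
  "tan_part A g B \<iota> q w =
     (THE v. \<forall>u. g (\<iota> q) (w - differential B A \<iota> q v) (differential B A \<iota> q u) = 0)"

definition nor_part ::
  "('m, 'e::euclidean_space) chart set \<Rightarrow> ('m \<Rightarrow> 'e \<Rightarrow> 'e \<Rightarrow> real) \<Rightarrow>
   ('n, 'd::euclidean_space) chart set \<Rightarrow> ('n \<Rightarrow> 'm) \<Rightarrow> 'n \<Rightarrow> 'e \<Rightarrow> 'e" where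
  "nor_part A g B \<iota> q w = w - differential B A \<iota> q (tan_part A g B \<iota> q w)"

definition push_field ::
  "('m, 'e::euclidean_space) chart set \<Rightarrow> ('n, 'd::euclidean_space) chart set \<Rightarrow>
   ('n \<Rightarrow> 'm) \<Rightarrow> ('n \<Rightarrow> 'd) \<Rightarrow> 'n \<Rightarrow> 'e" where
  "push_field A B \<iota> X = (\<lambda>q. differential B A \<iota> q (X q))"

text \<open>
  A vector field along \<open>\<iota>\<close> is a function \<open>V\<close> with \<open>V q\<close> in the ambient tangent space at \<open>\<iota> q\<close>. Its
  covariant derivative at \<open>q\<close> in the direction of a vector field \<open>X\<close> on the submanifold is obtained by
  extending both to ambient vector fields, which is possible near \<open>q\<close> because an immersion is
  locally an embedding; the result does not depend on the extensions.
\<close>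

definition extends_near ::
  "('m, 'e::euclidean_space) chart set \<Rightarrow> ('n::topological_space \<Rightarrow> 'm) \<Rightarrow> ('n \<Rightarrow> 'e) \<Rightarrow>
   'n \<Rightarrow> ('m \<Rightarrow> 'e) \<Rightarrow> bool" where
  "extends_near A \<iota> V q W \<longleftrightarrow> W \<in> vector_fields A \<and> (\<forall>\<^sub>F r in nhds q. W (\<iota> r) = V r)"

definition conn_along ::
  "('m, 'e::euclidean_space) chart set \<Rightarrow> ('n::topological_space, 'd::euclidean_space) chart set \<Rightarrow>
   ('n \<Rightarrow> 'm) \<Rightarrow> (('m \<Rightarrow> 'e) \<Rightarrow> ('m \<Rightarrow> 'e) \<Rightarrow> 'm \<Rightarrow> 'e) \<Rightarrow>
   ('n \<Rightarrow> 'd) \<Rightarrow> ('n \<Rightarrow> 'e) \<Rightarrow> 'n \<Rightarrow> 'e" where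
  "conn_along A B \<iota> nab X V = (\<lambda>q. THE w. \<exists>Z W.
     extends_near A \<iota> (push_field A B \<iota> X) q Z \<and> extends_near A \<iota> V q W \<and> w = nab Z W (\<iota> q))"

definition induced_conn where
  "induced_conn A g B \<iota> nab X Y =
     (\<lambda>q. tan_part A g B \<iota> q (conn_along A B \<iota> nab X (push_field A B \<iota> Y) q))"

definition second_form where
  "second_form A g B \<iota> nab X Y =
     (\<lambda>q. nor_part A g B \<iota> q (conn_along A B \<iota> nab X (push_field A B \<iota> Y) q))"

definition shape_op where
  "shape_op A g B \<iota> nab \<nu> X = (\<lambda>q. - tan_part A g B \<iota> q (conn_along A B \<iota> nab X \<nu> q))"

definition normal_conn where
  "normal_conn A g B \<iota> nab X \<nu> = (\<lambda>q. nor_part A g B \<iota> q (conn_along A B \<iota> nab X \<nu> q))"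

definition P_part where
  "P_part A g B \<iota> \<Theta> Y = (\<lambda>q. tan_part A g B \<iota> q (\<Theta> (\<iota> q) (push_field A B \<iota> Y q)))"

definition F_part where
  "F_part A g B \<iota> \<Theta> Y = (\<lambda>q. nor_part A g B \<iota> q (\<Theta> (\<iota> q) (push_field A B \<iota> Y q)))"

definition t_part where
  "t_part A g B \<iota> \<Theta> \<nu> = (\<lambda>q. tan_part A g B \<iota> q (\<Theta> (\<iota> q) (\<nu> q)))"

definition f_part where
  "f_part A g B \<iota> \<Theta> \<nu> = (\<lambda>q. nor_part A g B \<iota> q (\<Theta> (\<iota> q) (\<nu> q)))"

end

theory Submission
  imports Defs
begin

text \<open>
  The two equations are the tangential and the normal part of a single identity along the immersion.
  By the gauge equation, the derivative \<open>\<nabla>\<^sub>X (\<Theta> Y)\<close> equals \<open>\<Theta> (\<nabla>\<^sup>*\<^sub>X Y)\<close>. On the left, \<open>\<Theta> Y\<close> is the sum of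
  the tangent field \<open>P Y\<close> and the normal field \<open>F Y\<close>, whose derivatives are given by the Gauss and the
  Weingarten formula. On the right, \<open>\<nabla>\<^sup>*\<^sub>X Y\<close> is split by the Gauss formula before \<open>\<Theta>\<close> is applied.
  Comparing tangential and normal parts is linear algebra.

  The substance lies in the fact that the derivative \<open>conn_along\<close> of a field along the immersion, a
  definite description over ambient extensions, denotes what it should. This has two sides.

  The value does not depend on the extensions (\<open>conn_along_eq\<close>). Near a point, a vector field is a
  combination of coordinate fields; after multiplication with bump functions this holds globally
  (\<open>local_expansion\<close>), so the axioms of a connection apply. Hence \<open>\<nabla>\<^sub>Z W\<close> depends only on the value of
  \<open>Z\<close> at the point, and on \<open>W\<close> only along the immersion when \<open>Z\<close> is tangent to it.

  Extensions exist for the fields that occur. For the image of a smooth vector field of the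
  submanifold (\<open>exists_extension_push_field\<close>), an immersion has a smooth local left inverse
  (\<open>smooth_local_left_inverse\<close>, from the inverse function theorem), and precomposition with it extends
  functions from the submanifold to the ambient manifold. For \<open>P Y\<close> (\<open>exists_extension_tan_part\<close>),
  an extension of \<open>\<Theta> Y\<close> is projected orthogonally, within the ambient manifold, to the span of
  extended coordinate fields of the submanifold; the difference extends \<open>F Y\<close>. The projection is
  smooth because Gram--Schmidt orthogonalisation only involves products, sums and quotients
  (\<open>exists_projection\<close>).
\<close>

section \<open>Calculus of smooth functions on open sets\<close>

lemma Ck_on_cong:
  assumes "open S" "\<And>x. x \<in> S \<Longrightarrow> f x = g x" "Ck_on k S f"
  shows "Ck_on k S g"
  using assms(2,3)
proof (induction k arbitrary: f g)
  case 0
  then show ?case by (simp cong: continuous_on_cong)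
next
  case (Suc k)
  have d: "(g has_derivative frechet_derivative f (at x)) (at x)" if "x \<in> S" for x
    using Suc.prems that \<open>open S\<close>
    by (auto simp: frechet_derivative_works intro: has_derivative_transform_within_open)
  then have eq: "frechet_derivative f (at x) = frechet_derivative g (at x)" if "x \<in> S" for x
    using that frechet_derivative_at by blast
  have "Ck_on k S (\<lambda>x. frechet_derivative g (at x) v)" for v
    by (rule Suc.IH[of "\<lambda>x. frechet_derivative f (at x) v"]) (use Suc.prems eq in auto)
  then show ?case using d by (auto simp: differentiable_def)
qed

text \<open>Introduction rule with any formula for the derivative, so that the product, chain and quotient
  rules can be used without mentioning \<open>frechet_derivative\<close>.\<close>

lemma Ck_on_SucI:
  assumes "open S" "\<And>x. x \<in> S \<Longrightarrow> (f has_derivative f' x) (at x)"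
    and "\<And>v. Ck_on k S (\<lambda>x. f' x v)"
  shows "Ck_on (Suc k) S f"
proof -
  have "Ck_on k S (\<lambda>x. frechet_derivative f (at x) v)" for v
    by (rule Ck_on_cong[OF assms(1) _ assms(3)[of v]])
      (metis assms(2) frechet_derivative_at)
  then show ?thesis using assms(2) by (auto simp: differentiable_def)
qed

lemma Ck_on_has_derivative:
  "Ck_on (Suc k) S f \<Longrightarrow> x \<in> S \<Longrightarrow> (f has_derivative frechet_derivative f (at x)) (at x)"
  by (simp add: frechet_derivative_works)

lemma Ck_on_mono1: "Ck_on (Suc k) S f \<Longrightarrow> Ck_on k S f"
proof (induction k arbitrary: f)
  case 0
  then show ?case
    by (auto intro!: continuous_at_imp_continuous_on differentiable_imp_continuous_within)
qed auto

lemma Ck_on_continuous: "Ck_on k S f \<Longrightarrow> continuous_on S f"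
proof (induction k)
  case (Suc k)
  then show ?case using Ck_on_mono1 by blast
qed simp

lemma Ck_on_subset: "Ck_on k S f \<Longrightarrow> T \<subseteq> S \<Longrightarrow> Ck_on k T f"
  by (induction k arbitrary: f) (auto intro: continuous_on_subset)

lemma Ck_on_local:
  assumes "open S" "\<And>x. x \<in> S \<Longrightarrow> \<exists>T. open T \<and> x \<in> T \<and> Ck_on k T f"
  shows "Ck_on k S f"
  using assms(2)
proof (induction k arbitrary: f)
  case 0
  then show ?case
    by (auto intro!: continuous_at_imp_continuous_on) (metis continuous_on_eq_continuous_at)
next
  case (Suc k)
  have "Ck_on k S (\<lambda>x. frechet_derivative f (at x) v)" for v
    by (rule Suc.IH) (use Suc.prems in fastforce)
  moreover have "f differentiable (at x)" if "x \<in> S" for x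
    using Suc.prems[OF that] by auto
  ultimately show ?case by simp
qed

lemma Ck_on_const: "Ck_on k S (\<lambda>x. c)"
  by (induction k arbitrary: c) auto

lemma Ck_on_bounded_linear_compose:
  assumes "open S" "bounded_linear L" "Ck_on k S f"
  shows "Ck_on k S (\<lambda>x. L (f x))"
  using assms(3)
proof (induction k arbitrary: f)
  case 0
  then show ?case using linear_continuous_on_compose assms(2)
    by (auto intro: bounded_linear.continuous_on)
next
  case (Suc k)
  show ?case
    by (rule Ck_on_SucI[OF \<open>open S\<close>, where f' = "\<lambda>x v. L (frechet_derivative f (at x) v)"])
      (use Suc Ck_on_has_derivative[OF Suc.prems] in
        \<open>auto intro: bounded_linear.has_derivative[OF assms(2)]\<close>)
qed

lemma Ck_on_add:
  assumes "open S" "Ck_on k S f" "Ck_on k S g"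
  shows "Ck_on k S (\<lambda>x. f x + g x)"
  using assms(2,3)
proof (induction k arbitrary: f g)
  case 0
  then show ?case by (auto intro: continuous_intros)
next
  case (Suc k)
  show ?case
    by (rule Ck_on_SucI[OF \<open>open S\<close>, where f' = "\<lambda>x v. frechet_derivative f (at x) v
          + frechet_derivative g (at x) v"])
      (use Suc Ck_on_has_derivative[OF Suc.prems(1)] Ck_on_has_derivative[OF Suc.prems(2)] in
        \<open>auto intro: has_derivative_add\<close>)
qed

lemma Ck_on_bilinear:
  assumes "open S" "bounded_bilinear pr" "Ck_on k S f" "Ck_on k S g"
  shows "Ck_on k S (\<lambda>x. pr (f x) (g x))"
  using assms(3,4)
proof (induction k arbitrary: f g)
  case 0
  then show ?case using bounded_bilinear.continuous_on[OF assms(2)] by auto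
next
  case (Suc k)
  have "Ck_on k S (\<lambda>x. pr (f x) (frechet_derivative g (at x) v)
      + pr (frechet_derivative f (at x) v) (g x))" for v
    using Suc.prems Suc.prems[THEN Ck_on_mono1] by (auto intro!: Ck_on_add[OF \<open>open S\<close>] Suc.IH)
  then show ?case
    by (intro Ck_on_SucI[OF \<open>open S\<close>, where f' = "\<lambda>x v. pr (f x) (frechet_derivative g (at x) v)
          + pr (frechet_derivative f (at x) v) (g x)"] bounded_bilinear.FDERIV[OF assms(2)]
          Ck_on_has_derivative[OF Suc.prems(1)] Ck_on_has_derivative[OF Suc.prems(2)])
qed

lemmas Ck_on_scaleR = Ck_on_bilinear[OF _ bounded_bilinear_scaleR]
lemmas Ck_on_mult = Ck_on_bilinear[OF _ bounded_bilinear_mult]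
lemmas Ck_on_inner = Ck_on_bilinear[OF _ bounded_bilinear_inner]

lemma Ck_on_sum:
  "open S \<Longrightarrow> (\<And>i. i \<in> I \<Longrightarrow> Ck_on k S (f i)) \<Longrightarrow> Ck_on k S (\<lambda>x. \<Sum>i\<in>I. f i x)"
  by (induction I rule: infinite_finite_induct) (auto intro: Ck_on_add Ck_on_const)

text \<open>The derivative of \<open>1 / f\<close> is a product of a directional derivative of \<open>f\<close> with two copies of
  \<open>1 / f\<close> itself, so one order of smoothness of \<open>1 / f\<close> gives the next.\<close>

lemma Ck_on_inverse:
  fixes f :: "'a::real_normed_vector \<Rightarrow> real"
  assumes "open S" "Ck_on k S f" "\<And>x. x \<in> S \<Longrightarrow> f x \<noteq> 0"
  shows "Ck_on k S (\<lambda>x. inverse (f x))"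
  using assms(2)
proof (induction k)
  case 0
  then show ?case using assms(3) by (auto intro: continuous_intros)
next
  case (Suc k)
  have i: "Ck_on k S (\<lambda>x. inverse (f x))" using Suc Ck_on_mono1 by blast
  have "Ck_on k S (\<lambda>x. (-1) * (inverse (f x) * (frechet_derivative f (at x) v * inverse (f x))))" for v
    using Suc.prems by (intro Ck_on_mult Ck_on_const i \<open>open S\<close>) auto
  then have c: "Ck_on k S (\<lambda>x. - (inverse (f x) * frechet_derivative f (at x) v * inverse (f x)))" for v
    by (simp add: mult.assoc)
  show ?case
    by (rule Ck_on_SucI[OF \<open>open S\<close>, where f' = "\<lambda>x v. - (inverse (f x) *
          frechet_derivative f (at x) v * inverse (f x))", OF _ c])
      (use Deriv.has_derivative_inverse[OF _ Ck_on_has_derivative[OF Suc.prems]] assms(3) in blast)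
qed

lemma Ck_on_id: "open S \<Longrightarrow> Ck_on k S (\<lambda>x. x)"
  by (cases k) (auto intro: Ck_on_const)

lemma linear_basis_expansion:
  fixes L :: "'a::euclidean_space \<Rightarrow> 'b::real_vector"
  assumes "linear L"
  shows "L w = (\<Sum>b\<in>Basis. (w \<bullet> b) *\<^sub>R L b)"
proof -
  have "L w = L (\<Sum>b\<in>Basis. (w \<bullet> b) *\<^sub>R b)" by (simp add: euclidean_representation)
  then show ?thesis by (simp only: linear_sum[OF assms] linear_cmul[OF assms])
qed

text \<open>The directional derivatives of \<open>g \<circ> f\<close> are combinations of those of \<open>g\<close> along the basis,
  with the coordinates of the derivative of \<open>f\<close> as coefficients; this keeps the induction within
  directional derivatives of fixed direction.\<close>

lemma Ck_on_compose:
  fixes f :: "'a::real_normed_vector \<Rightarrow> 'b::euclidean_space"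
  assumes "open S" "open T" "Ck_on k S f" "Ck_on k T g" "f ` S \<subseteq> T"
  shows "Ck_on k S (\<lambda>x. g (f x))"
  using assms(3,4)
proof (induction k arbitrary: g)
  case 0
  then show ?case using assms(5) continuous_on_compose2 by auto
next
  case (Suc k)
  have f: "(f has_derivative frechet_derivative f (at x)) (at x)" if "x \<in> S" for x
    by (rule Ck_on_has_derivative[OF Suc.prems(1) that])
  have g: "(g has_derivative frechet_derivative g (at y)) (at y)" if "y \<in> T" for y
    by (rule Ck_on_has_derivative[OF Suc.prems(2) that])
  have "((\<lambda>x. g (f x)) has_derivative (\<lambda>v. \<Sum>b\<in>Basis. (frechet_derivative f (at x) v \<bullet> b) *\<^sub>R
      frechet_derivative g (at (f x)) b)) (at x)" if "x \<in> S" for x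
  proof -
    have g': "(g has_derivative frechet_derivative g (at (f x))) (at (f x))"
      using g assms(5) that by auto
    have "linear (frechet_derivative g (at (f x)))"
      using g' has_derivative_linear by blast
    then have "(\<lambda>v. frechet_derivative g (at (f x)) (frechet_derivative f (at x) v)) =
       (\<lambda>v. \<Sum>b\<in>Basis. (frechet_derivative f (at x) v \<bullet> b) *\<^sub>R frechet_derivative g (at (f x)) b)"
      by (intro ext linear_basis_expansion)
    with has_derivative_compose[OF f[OF that] g'] show ?thesis by (rule has_derivative_eq_rhs)
  qed
  moreover have "Ck_on k S (\<lambda>x. \<Sum>b\<in>Basis. (frechet_derivative f (at x) v \<bullet> b) *\<^sub>R
      frechet_derivative g (at (f x)) b)" for v
    using Suc.prems Suc.IH[OF Ck_on_mono1[OF Suc.prems(1)]]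
    by (auto intro!: Ck_on_sum Ck_on_scaleR Ck_on_inner Ck_on_const \<open>open S\<close>
        intro: Suc.IH[OF Ck_on_mono1[OF Suc.prems(1)], of "\<lambda>y. frechet_derivative g (at y) _"])
  ultimately show ?case by (rule Ck_on_SucI[OF \<open>open S\<close>])
qed

lemma smooth_on_cong:
  "open S \<Longrightarrow> (\<And>x. x \<in> S \<Longrightarrow> f x = g x) \<Longrightarrow> smooth_on S f \<Longrightarrow> smooth_on S g"
  unfolding smooth_on_def using Ck_on_cong by blast

lemma smooth_on_subset: "smooth_on S f \<Longrightarrow> T \<subseteq> S \<Longrightarrow> smooth_on T f"
  unfolding smooth_on_def using Ck_on_subset by blast

lemma smooth_on_local:
  "open S \<Longrightarrow> (\<And>x. x \<in> S \<Longrightarrow> \<exists>T. open T \<and> x \<in> T \<and> smooth_on T f) \<Longrightarrow> smooth_on S f"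
  unfolding smooth_on_def by (meson Ck_on_local)

lemma smooth_on_const: "smooth_on S (\<lambda>x. c)"
  by (simp add: smooth_on_def Ck_on_const)

lemma smooth_on_id: "open S \<Longrightarrow> smooth_on S (\<lambda>x. x)"
  by (simp add: smooth_on_def Ck_on_id)

lemma smooth_on_bounded_linear_compose:
  "open S \<Longrightarrow> bounded_linear L \<Longrightarrow> smooth_on S f \<Longrightarrow> smooth_on S (\<lambda>x. L (f x))"
  by (simp add: smooth_on_def Ck_on_bounded_linear_compose)

lemma smooth_on_add: "open S \<Longrightarrow> smooth_on S f \<Longrightarrow> smooth_on S g \<Longrightarrow> smooth_on S (\<lambda>x. f x + g x)"
  by (simp add: smooth_on_def Ck_on_add)

lemma smooth_on_sum:
  "open S \<Longrightarrow> (\<And>i. i \<in> I \<Longrightarrow> smooth_on S (f i)) \<Longrightarrow> smooth_on S (\<lambda>x. \<Sum>i\<in>I. f i x)"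
  by (simp add: smooth_on_def Ck_on_sum)

lemma smooth_on_scaleR:
  "open S \<Longrightarrow> smooth_on S f \<Longrightarrow> smooth_on S g \<Longrightarrow> smooth_on S (\<lambda>x. f x *\<^sub>R g x)"
  by (simp add: smooth_on_def Ck_on_scaleR)

lemma smooth_on_inner:
  "open S \<Longrightarrow> smooth_on S f \<Longrightarrow> smooth_on S g \<Longrightarrow> smooth_on S (\<lambda>x. f x \<bullet> g x)"
  by (simp add: smooth_on_def Ck_on_inner)

lemma smooth_on_mult:
  fixes f g :: "'a::real_normed_vector \<Rightarrow> real"
  shows "open S \<Longrightarrow> smooth_on S f \<Longrightarrow> smooth_on S g \<Longrightarrow> smooth_on S (\<lambda>x. f x * g x)"
  by (simp add: smooth_on_def Ck_on_mult)

lemma smooth_on_inverse: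
  fixes f :: "'a::real_normed_vector \<Rightarrow> real"
  shows "open S \<Longrightarrow> smooth_on S f \<Longrightarrow> (\<And>x. x \<in> S \<Longrightarrow> f x \<noteq> 0) \<Longrightarrow> smooth_on S (\<lambda>x. inverse (f x))"
  by (simp add: smooth_on_def Ck_on_inverse)

lemma smooth_on_compose:
  fixes f :: "'a::real_normed_vector \<Rightarrow> 'b::euclidean_space"
  shows "open S \<Longrightarrow> open T \<Longrightarrow> smooth_on S f \<Longrightarrow> smooth_on T g \<Longrightarrow> f ` S \<subseteq> T \<Longrightarrow>
    smooth_on S (\<lambda>x. g (f x))"
  by (simp add: smooth_on_def Ck_on_compose)

lemma smooth_on_has_derivative:
  "smooth_on S f \<Longrightarrow> x \<in> S \<Longrightarrow> (f has_derivative frechet_derivative f (at x)) (at x)"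
  unfolding smooth_on_def using Ck_on_has_derivative by blast

lemma smooth_on_continuous: "smooth_on S f \<Longrightarrow> continuous_on S f"
  unfolding smooth_on_def by (metis Ck_on.simps(1))

lemma smooth_on_directional_derivative:
  "smooth_on S f \<Longrightarrow> smooth_on S (\<lambda>x. frechet_derivative f (at x) v)"
  unfolding smooth_on_def by (metis Ck_on.simps(2))

text \<open>\<open>Ck_on\<close> only speaks of derivatives in constant directions; expansion in the basis allows the
  direction to vary smoothly with the point.\<close>

lemma smooth_on_derivative_apply:
  fixes f :: "'a::euclidean_space \<Rightarrow> 'b::real_normed_vector"
  assumes "open S" "smooth_on S f" "smooth_on S w"
  shows "smooth_on S (\<lambda>x. frechet_derivative f (at x) (w x))"
proof (rule smooth_on_cong[OF assms(1)])
  show "smooth_on S (\<lambda>x. \<Sum>b\<in>Basis. (w x \<bullet> b) *\<^sub>R frechet_derivative f (at x) b)"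
    using assms by (intro smooth_on_sum smooth_on_scaleR smooth_on_inner smooth_on_const
        smooth_on_directional_derivative)
  fix x assume "x \<in> S"
  then have "linear (frechet_derivative f (at x))"
    using smooth_on_has_derivative[OF assms(2)] has_derivative_linear by blast
  then show "(\<Sum>b\<in>Basis. (w x \<bullet> b) *\<^sub>R frechet_derivative f (at x) b) = frechet_derivative f (at x) (w x)"
    by (rule linear_basis_expansion[symmetric])
qed

section \<open>Bump functions\<close>

text \<open>The classical flat function \<open>exp (- 1 / t)\<close> for \<open>n = 0\<close>. The extra factors \<open>1 / t\<close> make the family
  closed under differentiation up to linear combinations.\<close>

definition exp_flat :: "nat \<Rightarrow> real \<Rightarrow> real" where
  "exp_flat n t = (if t \<le> 0 then 0 else inverse t ^ n * exp (- inverse t))"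

lemma exp_flat_tendsto_0: "((\<lambda>t. exp_flat n t) \<longlongrightarrow> 0) (at 0)"
proof -
  have "filterlim (\<lambda>t. exp_flat n t) (nhds 0) (at_right 0)"
  proof -
    have "((\<lambda>t::real. inverse t ^ n / exp (inverse t)) \<longlongrightarrow> 0) (at_right 0)"
      using filterlim_compose[OF tendsto_power_div_exp_0 filterlim_inverse_at_top_right] by simp
    then show ?thesis
      by (rule Lim_transform_eventually)
        (auto simp: eventually_at_right_less exp_flat_def exp_minus field_simps
          intro!: eventually_at_rightI[of 0 1])
  qed
  moreover have "filterlim (\<lambda>t. exp_flat n t) (nhds 0) (at_left 0)"
    by (rule Lim_transform_eventually[of "\<lambda>_. 0"])
      (auto simp: exp_flat_def intro!: eventually_at_leftI[of "-1" 0])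
  ultimately show ?thesis
    by (simp add: filterlim_at_split)
qed

lemma exp_flat_DERIV:
  "(exp_flat n has_real_derivative exp_flat (n + 2) t - n * exp_flat (n + 1) t) (at t)"
proof (cases "t = 0")
  case True
  have "((\<lambda>h. (exp_flat n (0 + h) - exp_flat n 0) / h) \<longlongrightarrow> 0) (at 0)"
    by (rule Lim_transform_eventually[OF exp_flat_tendsto_0[of "Suc n"]])
      (auto simp: exp_flat_def field_simps eventually_at intro!: exI[of _ 1])
  then show ?thesis using True by (simp add: DERIV_def exp_flat_def)
next
  case False
  show ?thesis
  proof (cases "t > 0")
    case True
    have "real n * inverse t ^ (n - Suc 0) * (inverse t * inverse t) = real n * inverse t ^ (n + 1)"
      by (cases n) auto
    then have "((\<lambda>t. inverse t ^ n * exp (- inverse t)) has_real_derivative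
        exp_flat (n + 2) t - n * exp_flat (n + 1) t) (at t)"
      using True by (auto intro!: derivative_eq_intros simp: exp_flat_def algebra_simps power2_eq_square)
    then show ?thesis
      by (rule has_field_derivative_transform_within_open[of _ _ _ "{0<..}"])
        (use True in \<open>auto simp: exp_flat_def\<close>)
  next
    case f: False
    have "(exp_flat n has_real_derivative 0) (at t)"
      by (rule has_field_derivative_transform_within_open[of "\<lambda>_. 0" _ _ "{..<0}"])
        (use f False in \<open>auto simp: exp_flat_def\<close>)
    then show ?thesis using f by (auto simp: exp_flat_def)
  qed
qed

text \<open>Differentiation maps the functions \<open>exp_flat n\<close> to combinations of each other, so the
  smoothness of all of them follows by one induction.\<close>

lemma smooth_on_exp_flat: "smooth_on UNIV (exp_flat n)"
proof -
  have "Ck_on k UNIV (exp_flat n)" for k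
  proof (induction k arbitrary: n)
    case 0
    then show ?case
      by (auto intro!: continuous_at_imp_continuous_on DERIV_isCont[OF exp_flat_DERIV])
  next
    case (Suc k)
    have "Ck_on k UNIV (\<lambda>t. (exp_flat (n + 2) t + (- real n) * exp_flat (n + 1) t) * v)" for v
      by (intro Ck_on_mult Ck_on_add Ck_on_const Suc.IH open_UNIV)
    then show ?case
      by (intro Ck_on_SucI[where f' = "\<lambda>t v. (exp_flat (n + 2) t + (- real n) * exp_flat (n + 1) t) * v"])
        (use exp_flat_DERIV in \<open>auto simp: has_field_derivative_def\<close>)
  qed
  then show ?thesis by (simp add: smooth_on_def)
qed

lemma exp_flat_pos: "t > 0 \<Longrightarrow> exp_flat n t > 0" and exp_flat_nonneg: "exp_flat n t \<ge> 0"
  and exp_flat_zero: "t \<le> 0 \<Longrightarrow> exp_flat n t = 0"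
  by (auto simp: exp_flat_def)

text \<open>With \<open>u\<close> positive exactly inside the ball of radius \<open>r\<close> and \<open>w\<close> positive exactly outside the ball
  of radius \<open>r / 2\<close>, the quotient \<open>u / (u + w)\<close> is a bump function: its denominator never vanishes.\<close>

lemma smooth_bump:
  fixes a :: "'a::euclidean_space"
  assumes "open U" "a \<in> U"
  obtains \<phi> :: "'a \<Rightarrow> real" and K where "smooth_on UNIV \<phi>" "compact K" "K \<subseteq> U"
    "\<And>x. x \<notin> K \<Longrightarrow> \<phi> x = 0" "\<phi> a = 1" "eventually (\<lambda>x. \<phi> x = 1) (nhds a)"
proof -
  obtain r where r: "r > 0" "cball a r \<subseteq> U" using assms open_contains_cball by blast
  define n2 where "n2 x = (x - a) \<bullet> (x - a)" for x
  have n2: "n2 x = (dist a x)\<^sup>2" for x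
    by (simp add: n2_def dist_norm power2_norm_eq_inner[symmetric] norm_minus_commute)
  define u where "u x = exp_flat 0 (r\<^sup>2 - n2 x)" for x
  define w where "w x = exp_flat 0 (n2 x - (r/2)\<^sup>2)" for x
  have s: "smooth_on UNIV n2"
    using smooth_on_add[OF open_UNIV smooth_on_id[OF open_UNIV] smooth_on_const[of UNIV "-a"]]
    unfolding n2_def by (intro smooth_on_inner) auto
  have su: "smooth_on UNIV (\<lambda>x. exp_flat 0 (c + d * n2 x))" for c d
    by (rule smooth_on_compose[OF open_UNIV open_UNIV _ smooth_on_exp_flat])
      (auto intro!: smooth_on_add smooth_on_mult smooth_on_const s)
  have u: "smooth_on UNIV u" using su[of "r\<^sup>2" "-1"] by (simp add: u_def[abs_def])
  have w: "smooth_on UNIV w" using su[of "-(r/2)\<^sup>2" "1"] by (simp add: w_def[abs_def] add.commute)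
  have pos: "u x + w x > 0" for x
  proof (cases "n2 x < r\<^sup>2")
    case True
    then show ?thesis using exp_flat_pos exp_flat_nonneg
      by (simp add: u_def w_def add_pos_nonneg)
  next
    case False
    then have "n2 x > (r/2)\<^sup>2" using r by (simp add: power2_eq_square field_simps)
       (smt (verit) mult_pos_pos)
    then show ?thesis using exp_flat_pos exp_flat_nonneg
      by (simp add: u_def w_def add_nonneg_pos)
  qed
  define \<phi> where "\<phi> x = u x * inverse (u x + w x)" for x
  have one: "\<phi> x = 1" if "x \<in> ball a (r/2)" for x
  proof -
    have "n2 x \<le> (r/2)\<^sup>2" using that by (simp add: n2 power_mono)
    then have "w x = 0" by (simp add: w_def exp_flat_zero)
    then show ?thesis using pos[of x] by (simp add: \<phi>_def)
  qed
  show thesis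
  proof
    show "smooth_on UNIV \<phi>" unfolding \<phi>_def
      using pos by (intro smooth_on_mult smooth_on_inverse smooth_on_add u w open_UNIV) (metis less_irrefl)
    show "compact (cball a r)" by simp
    show "cball a r \<subseteq> U" by (rule r)
    show "\<phi> x = 0" if "x \<notin> cball a r" for x
    proof -
      have "r\<^sup>2 \<le> n2 x" using that r by (simp add: n2 power_mono)
      then show ?thesis by (simp add: \<phi>_def u_def exp_flat_zero)
    qed
    show "\<phi> a = 1" using one r by simp
    show "eventually (\<lambda>x. \<phi> x = 1) (nhds a)"
      using one r unfolding eventually_nhds by (intro exI[of _ "ball a (r/2)"]) auto
  qed
qed

section \<open>Orthogonal projection with smooth coefficients\<close>

text \<open>Gram--Schmidt orthogonalisation uses only ring operations on the coefficients and division by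
  the squared length of a vector that does not vanish at the point in question. It therefore works
  over any ring \<open>C\<close> of coefficient functions in which a function that is nonzero at \<open>p\<close> is invertible
  near \<open>p\<close>. There are two instances below: functions of class \<open>C\<^sup>k\<close> near a point with the Euclidean
  inner product, which gives the regularity of inverse matrices, and smooth functions on a manifold
  with the Riemannian metric, which gives the regularity of tangential parts. Independence at
  the single point \<open>p\<close> yields projections near \<open>p\<close>, because the squared lengths to be inverted are
  nonzero at \<open>p\<close>.\<close>

locale local_projection =
  fixes p :: "'x::topological_space" and C :: "('x \<Rightarrow> real) set"
    and V :: "('x \<Rightarrow> 'v::real_vector) set" and G :: "'x \<Rightarrow> 'v \<Rightarrow> 'v \<Rightarrow> real"
  assumes coeff_mult: "\<lbrakk>a \<in> C; b \<in> C\<rbrakk> \<Longrightarrow> (\<lambda>x. a x * b x) \<in> C"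
    and coeff_inverse: "\<lbrakk>c \<in> C; c p \<noteq> 0\<rbrakk> \<Longrightarrow> \<exists>d\<in>C. \<forall>\<^sub>F x in nhds p. d x * c x = 1"
    and field_zero: "(\<lambda>x. 0) \<in> V"
    and field_add: "\<lbrakk>X \<in> V; Y \<in> V\<rbrakk> \<Longrightarrow> (\<lambda>x. X x + Y x) \<in> V"
    and field_diff: "\<lbrakk>X \<in> V; Y \<in> V\<rbrakk> \<Longrightarrow> (\<lambda>x. X x - Y x) \<in> V"
    and field_scale: "\<lbrakk>c \<in> C; X \<in> V\<rbrakk> \<Longrightarrow> (\<lambda>x. c x *\<^sub>R X x) \<in> V"
    and metric_coeff: "\<lbrakk>X \<in> V; Y \<in> V\<rbrakk> \<Longrightarrow> (\<lambda>x. G x (X x) (Y x)) \<in> C"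
    and metric_bilinear: "bilinear (G x)"
    and metric_sym: "G x u v = G x v u"
    and metric_pos: "v \<noteq> 0 \<Longrightarrow> G x v v > 0"
begin

lemma orthogonal_span:
  assumes "\<And>e. e \<in> B \<Longrightarrow> G x w e = 0" "v \<in> span B"
  shows "G x w v = 0"
  using linear_eq_0_on_span[of "G x w" B v] assms metric_bilinear by (auto simp: bilinear_def)

text \<open>Induction on the number of fields: a new field \<open>E i\<close> is replaced by its part \<open>e\<close> orthogonal to the
  previous ones, which spans the same space together with them, and the projection along \<open>e\<close> is added
  to the projection to the previous fields.\<close>

lemma exists_projection:
  assumes "finite I" "\<And>i. i \<in> I \<Longrightarrow> E i \<in> V"
    and "inj_on (\<lambda>i. E i p) I" "independent ((\<lambda>i. E i p) ` I)" "W \<in> V"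
  shows "\<exists>W'\<in>V. \<forall>\<^sub>F x in nhds p. W' x \<in> span ((\<lambda>i. E i x) ` I) \<and>
           (\<forall>i\<in>I. G x (W x - W' x) (E i x) = 0)"
  using assms
proof (induction I arbitrary: W rule: finite_induct)
  case empty
  then show ?case using field_zero by (auto intro!: bexI[of _ "\<lambda>x. 0"])
next
  case (insert i I)
  have inj: "inj_on (\<lambda>i. E i p) I" and ind: "independent ((\<lambda>i. E i p) ` I)"
    and notin: "E i p \<notin> span ((\<lambda>i. E i p) ` I)" and Ei: "E i \<in> V"
    and EI: "\<And>j. j \<in> I \<Longrightarrow> E j \<in> V"
    using insert.prems insert.hyps by (auto simp: independent_insert inj_on_def split: if_splits)
  obtain e0 where e0: "e0 \<in> V" "\<forall>\<^sub>F x in nhds p. e0 x \<in> span ((\<lambda>i. E i x) ` I) \<and>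
           (\<forall>j\<in>I. G x (E i x - e0 x) (E j x) = 0)"
    using insert.IH[OF EI inj ind Ei] by blast
  obtain W0 where W0: "W0 \<in> V" "\<forall>\<^sub>F x in nhds p. W0 x \<in> span ((\<lambda>i. E i x) ` I) \<and>
           (\<forall>j\<in>I. G x (W x - W0 x) (E j x) = 0)"
    using insert.IH[OF EI inj ind \<open>W \<in> V\<close>] by blast
  define e where "e x = E i x - e0 x" for x
  have e: "e \<in> V" using field_diff[OF Ei e0(1)] by (simp add: e_def[abs_def])
  have "e p \<noteq> 0" using notin eventually_nhds_x_imp_x[OF e0(2)] by (auto simp: e_def)
  then have "G p (e p) (e p) \<noteq> 0" using metric_pos by (metis less_irrefl)
  then obtain d where d: "d \<in> C" "\<forall>\<^sub>F x in nhds p. d x * G x (e x) (e x) = 1"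
    using coeff_inverse[OF metric_coeff[OF e e]] by blast
  define k where "k x = d x * G x (W x) (e x)" for x
  have k: "k \<in> C"
    using coeff_mult[OF d(1) metric_coeff[OF \<open>W \<in> V\<close> e]] by (simp add: k_def[abs_def])
  define W' where "W' x = W0 x + k x *\<^sub>R e x" for x
  have W': "W' \<in> V"
    using field_add[OF W0(1) field_scale[OF k e]] by (simp add: W'_def[abs_def])
  have "\<forall>\<^sub>F x in nhds p. W' x \<in> span ((\<lambda>i. E i x) ` insert i I) \<and>
           (\<forall>j\<in>insert i I. G x (W x - W' x) (E j x) = 0)"
    using e0(2) W0(2) d(2)
  proof eventually_elim
    case (elim x)
    let ?S = "span ((\<lambda>i. E i x) ` I)"
    note bl = bilinear_lsub[OF metric_bilinear] bilinear_rsub[OF metric_bilinear]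
      bilinear_ladd[OF metric_bilinear] bilinear_radd[OF metric_bilinear]
      bilinear_lmul[OF metric_bilinear] bilinear_rmul[OF metric_bilinear]
    have sub: "?S \<subseteq> span ((\<lambda>i. E i x) ` insert i I)" by (rule span_mono) auto
    have orth_e: "G x (e x) v = 0" if "v \<in> ?S" for v
      by (rule orthogonal_span[OF _ that]) (use elim(1) in \<open>auto simp: e_def\<close>)
    have orth_W: "G x (W x - W0 x) v = 0" if "v \<in> ?S" for v
      by (rule orthogonal_span[OF _ that]) (use elim(2) in auto)
    have rem: "W x - W' x = (W x - W0 x) - k x *\<^sub>R e x" by (simp add: W'_def)
    have orth: "G x (W x - W' x) v = 0" if "v \<in> ?S" for v
      unfolding rem using orth_e[OF that] orth_W[OF that] by (simp add: bl)
    have "G x (W0 x) (e x) = 0" using orth_e[of "W0 x"] elim(2) metric_sym by metis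
    then have "G x (W x - W' x) (e x) = G x (W x) (e x) * (1 - d x * G x (e x) (e x))"
      unfolding rem by (simp add: bl k_def algebra_simps)
    then have "G x (W x - W' x) (e x) = 0" using elim(3) by simp
    moreover have "E i x = e x + e0 x" by (simp add: e_def)
    ultimately have "G x (W x - W' x) (E i x) = 0"
      using orth[of "e0 x"] elim(1) by (simp add: bl)
    moreover have "E i x - e0 x \<in> span ((\<lambda>i. E i x) ` insert i I)"
      using elim(1) sub by (intro span_diff) (auto intro: span_base)
    then have "W' x \<in> span ((\<lambda>i. E i x) ` insert i I)"
      using elim(2) sub unfolding W'_def e_def by (intro span_add span_scale) auto
    ultimately show ?case using orth by (auto intro: span_base)
  qed
  then show ?case using W' by blast
qed

end

section \<open>Smooth left inverses of immersions\<close>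

text \<open>The coordinate \<open>i\<close> of \<open>inv (M x) v\<close> is the inner product of \<open>v\<close> with the dual vector of the column
  \<open>M x i\<close>. That dual vector is the part \<open>e x\<close> of the column orthogonal to the other columns, divided by
  its squared length, so the projection lemma yields its regularity.\<close>

lemma Ck_on_inverse_linear:
  fixes M :: "'a::real_normed_vector \<Rightarrow> 'd \<Rightarrow> 'd::euclidean_space"
  assumes "open S" and lin: "\<And>x. x \<in> S \<Longrightarrow> linear (M x)" and bij: "\<And>x. x \<in> S \<Longrightarrow> bij (M x)"
    and M: "\<And>v. Ck_on k S (\<lambda>x. M x v)"
  shows "Ck_on k S (\<lambda>x. inv (M x) v)"
proof -
  have "Ck_on k S (\<lambda>x. inv (M x) v \<bullet> i)" if i: "i \<in> Basis" for i :: 'd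
  proof (rule Ck_on_local[OF \<open>open S\<close>])
    fix x0 assume "x0 \<in> S"
    define C :: "('a \<Rightarrow> real) set" where "C = {c. \<exists>T. open T \<and> x0 \<in> T \<and> Ck_on k T c}"
    define V :: "('a \<Rightarrow> 'd) set" where "V = {c. \<exists>T. open T \<and> x0 \<in> T \<and> Ck_on k T c}"
    have both: "\<exists>T. open T \<and> x0 \<in> T \<and> Ck_on k T a \<and> Ck_on k T b"
      if "\<exists>T. open T \<and> x0 \<in> T \<and> Ck_on k T a" "\<exists>T. open T \<and> x0 \<in> T \<and> Ck_on k T b"
      for a :: "'a \<Rightarrow> 'b::real_normed_vector" and b :: "'a \<Rightarrow> 'c::real_normed_vector"
      using that by (meson Ck_on_subset IntI Int_lower1 Int_lower2 open_Int)
    interpret local_projection x0 C V "\<lambda>_. (\<bullet>)"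
    proof
      show "(\<lambda>x. a x * b x) \<in> C" if "a \<in> C" "b \<in> C" for a b
        using both[of a b] that Ck_on_mult unfolding C_def by blast
      show "(\<lambda>x. a x \<bullet> b x) \<in> C" if "a \<in> V" "b \<in> V" for a b
        using both[of a b] that Ck_on_inner unfolding C_def V_def by blast
      show "(\<lambda>x. a x *\<^sub>R b x) \<in> V" if "a \<in> C" "b \<in> V" for a b
        using both[of a b] that Ck_on_scaleR unfolding C_def V_def by blast
      show add: "(\<lambda>x. a x + b x) \<in> V" if "a \<in> V" "b \<in> V" for a b
        using both[of a b] that Ck_on_add unfolding V_def by blast
      show "(\<lambda>x. a x - b x) \<in> V" if "a \<in> V" "b \<in> V" for a b
      proof -
        have "(\<lambda>x. - b x) \<in> V"
          using that(2) Ck_on_bounded_linear_compose[OF _ bounded_linear_minus[OF bounded_linear_ident]]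
          unfolding V_def by blast
        from add[OF that(1) this] show ?thesis by simp
      qed
      show "(\<lambda>x. 0) \<in> V" using Ck_on_const unfolding V_def by blast
      show "\<exists>d\<in>C. \<forall>\<^sub>F x in nhds x0. d x * c x = 1" if c: "c \<in> C" "c x0 \<noteq> 0" for c
      proof -
        obtain T where T: "open T" "x0 \<in> T" "Ck_on k T c" using c(1) unfolding C_def by blast
        have "continuous_on T c" using T(3) by (rule Ck_on_continuous)
        then have "open (T \<inter> c -` (- {0}))"
          using T(1) by (simp add: continuous_open_preimage open_Compl)
        moreover have "x0 \<in> T \<inter> c -` (- {0})" using T c by auto
        moreover from calculation have "Ck_on k (T \<inter> c -` (- {0})) (\<lambda>x. inverse (c x))"
          using Ck_on_subset[OF T(3)] by (intro Ck_on_inverse) auto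
        ultimately have "(\<lambda>x. inverse (c x)) \<in> C"
            "\<forall>\<^sub>F x in nhds x0. x \<in> T \<inter> c -` (- {0})"
          unfolding C_def by (blast, meson eventually_nhds)
        then show ?thesis by (auto elim!: bexI[rotated] eventually_mono)
      qed
      show "bilinear (\<lambda>x y :: 'd. x \<bullet> y)"
        by (simp add: bilinear_conv_bounded_bilinear bounded_bilinear_inner)
    qed (auto simp: inner_commute)
    have inj: "inj (M x0)" using bij[OF \<open>x0 \<in> S\<close>] bij_is_inj by blast
    have MV: "(\<lambda>x. M x b) \<in> V" for b using M \<open>open S\<close> \<open>x0 \<in> S\<close> V_def by blast
    have indB: "independent (M x0 ` Basis)"
      using linear_independent_injective_image[OF lin[OF \<open>x0 \<in> S\<close>] independent_Basis] inj by simp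
    have notin: "M x0 i \<notin> span (M x0 ` (Basis - {i}))"
    proof -
      have "i \<notin> span (Basis - {i})"
        using independent_Basis i dependent_def by blast
      then show ?thesis
        using linear_span_image[OF lin[OF \<open>x0 \<in> S\<close>], of "Basis - {i}"] inj by (auto simp: inj_image_mem_iff)
    qed
    obtain W' where W': "W' \<in> V" "\<forall>\<^sub>F x in nhds x0. W' x \<in> span ((\<lambda>b. M x b) ` (Basis - {i})) \<and>
        (\<forall>b\<in>Basis - {i}. (M x i - W' x) \<bullet> M x b = 0)"
      using exists_projection[of "Basis - {i}" "\<lambda>b x. M x b" "\<lambda>x. M x i"] MV inj
        independent_mono[OF indB, of "M x0 ` (Basis - {i})"]
      by (auto simp: inj_on_def)
    \<comment> \<open>Up to the factor \<open>d x\<close>, this is the dual vector of the column \<open>M x i\<close>.\<close>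
    define e where "e x = M x i - W' x" for x
    have e: "e \<in> V" using field_diff[OF MV W'(1)] by (simp add: e_def[abs_def])
    have "e x0 \<noteq> 0" using notin eventually_nhds_x_imp_x[OF W'(2)] by (auto simp: e_def)
    then have "e x0 \<bullet> e x0 \<noteq> 0" by simp
    then obtain d where d: "d \<in> C" "\<forall>\<^sub>F x in nhds x0. d x * (e x \<bullet> e x) = 1"
      using coeff_inverse[OF metric_coeff[OF e e]] by blast
    have vV: "(\<lambda>x. v) \<in> V" unfolding V_def using Ck_on_const by blast
    have "(\<lambda>x. d x * (e x \<bullet> v)) \<in> C"
      using coeff_mult[OF d(1) metric_coeff[OF e vV]] .
    then obtain T where T: "open T" "x0 \<in> T" "Ck_on k T (\<lambda>x. d x * (e x \<bullet> v))"
      by (auto simp: C_def)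
    have "\<forall>\<^sub>F x in nhds x0. x \<in> S" using \<open>open S\<close> \<open>x0 \<in> S\<close> eventually_nhds by blast
    with W'(2) d(2) have "\<forall>\<^sub>F x in nhds x0. d x * (e x \<bullet> v) = inv (M x) v \<bullet> i"
    proof eventually_elim
      case (elim x)
      have e0: "e x \<bullet> b = 0" if "b \<in> span (M x ` (Basis - {i}))" for b
        by (rule orthogonal_span[OF _ that]) (use elim(1) in \<open>auto simp: e_def\<close>)
      have "e x \<bullet> M x i = e x \<bullet> e x + e x \<bullet> W' x"
        by (simp add: e_def inner_diff_right)
      then have ei: "e x \<bullet> M x i = e x \<bullet> e x" using e0 elim(1) by simp
      have "e x \<bullet> M x w = (w \<bullet> i) * (e x \<bullet> e x)" for w
      proof -
        have "e x \<bullet> M x w = (\<Sum>b\<in>Basis. (w \<bullet> b) * (e x \<bullet> M x b))"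
          by (subst linear_basis_expansion[OF lin[OF elim(3)]]) (simp add: inner_sum_right)
        also have "\<dots> = (\<Sum>b\<in>Basis. if b = i then (w \<bullet> i) * (e x \<bullet> e x) else 0)"
          by (rule sum.cong) (auto simp: ei intro: e0 span_base)
        finally show ?thesis using i by simp
      qed
      from this[of "inv (M x) v"] have "e x \<bullet> v = (inv (M x) v \<bullet> i) * (e x \<bullet> e x)"
        by (simp add: surj_f_inv_f bij_is_surj bij elim(3))
      then show ?case using elim(2) by (simp add: mult.left_commute)
    qed
    then obtain T' where T': "open T'" "x0 \<in> T'"
      "\<And>x. x \<in> T' \<Longrightarrow> d x * (e x \<bullet> v) = inv (M x) v \<bullet> i"
      unfolding eventually_nhds by blast
    have "Ck_on k (T \<inter> T') (\<lambda>x. inv (M x) v \<bullet> i)"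
      by (rule Ck_on_cong[OF _ _ Ck_on_subset[OF T(3)]]) (use T T' in auto)
    then show "\<exists>T. open T \<and> x0 \<in> T \<and> Ck_on k T (\<lambda>x. inv (M x) v \<bullet> i)"
      using T T' by (intro exI[of _ "T \<inter> T'"]) auto
  qed
  then have "Ck_on k S (\<lambda>x. \<Sum>i\<in>Basis. (inv (M x) v \<bullet> i) *\<^sub>R i)"
    by (intro Ck_on_sum Ck_on_scaleR Ck_on_const \<open>open S\<close>)
  then show ?thesis by (simp add: euclidean_representation)
qed

text \<open>Compose \<open>f\<close> with a linear left inverse \<open>T\<close> of its derivative at \<open>x0\<close>. The map \<open>T \<circ> f\<close> has invertible
  derivative at \<open>x0\<close>, hence a local inverse \<open>\<psi>\<close>, and \<open>\<psi> \<circ> T\<close> is a left inverse of \<open>f\<close>. The inverse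
  function theorem only provides the first derivative of \<open>\<psi>\<close>; as this is the inverse matrix
  evaluated along \<open>\<psi>\<close>, higher regularity follows by bootstrapping.\<close>

lemma smooth_local_left_inverse:
  fixes f :: "'d::euclidean_space \<Rightarrow> 'e::euclidean_space"
  assumes "open \<Omega>" "smooth_on \<Omega> f" "x0 \<in> \<Omega>" "inj (frechet_derivative f (at x0))"
  obtains \<rho> V U where "open V" "smooth_on V \<rho>" "\<rho> ` V \<subseteq> \<Omega>"
    "open U" "x0 \<in> U" "U \<subseteq> \<Omega>" "\<And>x. x \<in> U \<Longrightarrow> f x \<in> V \<and> \<rho> (f x) = x"
proof -
  have lin: "linear (frechet_derivative f (at x0))"
    using smooth_on_has_derivative[OF assms(2,3)] has_derivative_linear by blast
  obtain T where T: "linear T" "T \<circ> frechet_derivative f (at x0) = id"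
    using linear_injective_left_inverse[OF lin assms(4)] by blast
  have bT: "bounded_linear T" using T(1) by (simp add: linear_conv_bounded_linear)
  define h where "h x = T (f x)" for x
  have h: "smooth_on \<Omega> h" unfolding h_def[abs_def]
    by (rule smooth_on_bounded_linear_compose[OF assms(1) bT assms(2)])
  define h' where "h' x = Blinfun (frechet_derivative h (at x))" for x
  have h'_apply: "blinfun_apply (h' x) = frechet_derivative h (at x)" if "x \<in> \<Omega>" for x
    using has_derivative_bounded_linear[OF smooth_on_has_derivative[OF h that]]
    by (simp add: h'_def bounded_linear_Blinfun_apply)
  have derh: "(h has_derivative blinfun_apply (h' x)) (at x)" if "x \<in> \<Omega>" for x
    using smooth_on_has_derivative[OF h that] h'_apply[OF that] by simp
  have "continuous_on \<Omega> (\<lambda>x. blinfun_apply (h' x) v)" for v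
    using smooth_on_continuous[OF smooth_on_directional_derivative[OF h, of v]] h'_apply
    by (simp cong: continuous_on_cong)
  then have conth: "continuous_on \<Omega> h'" by (intro continuous_on_blinfun_componentwise) auto
  have "frechet_derivative h (at x0) = T \<circ> frechet_derivative f (at x0)"
    using bounded_linear.has_derivative[OF bT smooth_on_has_derivative[OF assms(2,3)]]
    by (simp add: frechet_derivative_at[symmetric] h_def[abs_def] comp_def)
  then have id: "id_blinfun o\<^sub>L h' x0 = id_blinfun"
    using T(2) h'_apply[OF assms(3)] by (intro blinfun_eqI) (auto simp: fun_eq_iff)
  obtain U' V' \<psi> \<psi>' where U': "open U'" "U' \<subseteq> \<Omega>" "x0 \<in> U'" and V': "open V'"
    and hom: "homeomorphism U' V' h \<psi>"
    and der: "\<And>y. y \<in> V' \<Longrightarrow> (\<psi> has_derivative (\<psi>' y)) (at y)"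
    and der': "\<And>y. y \<in> V' \<Longrightarrow> \<psi>' y = inv (blinfun_apply (h' (\<psi> y)))"
    and bij: "\<And>y. y \<in> V' \<Longrightarrow> bij (blinfun_apply (h' (\<psi> y)))"
  proof (rule inverse_function_theorem[OF assms(1) _ conth assms(3) id])
    show "(h has_derivative blinfun_apply (h' x)) (at x)" if "x \<in> \<Omega>" for x
      by (rule derh[OF that])
  next
    fix U' V g g'
    assume a: "open U'" "U' \<subseteq> \<Omega>" "x0 \<in> U'" "open V" "homeomorphism U' V h g"
      and b: "\<And>y. y \<in> V \<Longrightarrow> (g has_derivative (g' y)) (at y)"
        "\<And>y. y \<in> V \<Longrightarrow> g' y = inv (blinfun_apply (h' (g y)))"
        "\<And>y. y \<in> V \<Longrightarrow> bij (blinfun_apply (h' (g y)))"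
    show thesis by (rule that[OF a b])
  qed
  have img: "\<psi> ` V' \<subseteq> \<Omega>" using hom U'(2) by (auto simp: homeomorphism_def)
  have "Ck_on k V' \<psi>" for k
  proof (induction k)
    case 0
    then show ?case using hom by (simp add: homeomorphism_def)
  next
    case (Suc k)
    have "Ck_on k \<Omega> (\<lambda>x. frechet_derivative h (at x) v)" for v
      using smooth_on_directional_derivative[OF h] by (simp add: smooth_on_def)
    then have "Ck_on k \<Omega> (\<lambda>x. blinfun_apply (h' x) v)" for v
      by (rule Ck_on_cong[OF assms(1), rotated]) (simp add: h'_apply)
    then have M: "Ck_on k V' (\<lambda>y. blinfun_apply (h' (\<psi> y)) v)" for v
      by (rule Ck_on_compose[OF V' assms(1) Suc _ img])
    have "Ck_on k V' (\<lambda>y. inv (blinfun_apply (h' (\<psi> y))) v)" for v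
      by (rule Ck_on_inverse_linear[OF V' _ bij M])
        (simp_all add: bounded_linear.linear blinfun.bounded_linear_right)
    then show ?case using der der' by (intro Ck_on_SucI[OF V']) auto
  qed
  then have \<psi>: "smooth_on V' \<psi>" by (simp add: smooth_on_def)
  have oV: "open (T -` V')"
    using V' bT linear_continuous_on continuous_on_open_vimage[of UNIV T] by auto
  show thesis
  proof (rule that[of "T -` V'" "\<lambda>y. \<psi> (T y)" U'])
    show "smooth_on (T -` V') (\<lambda>y. \<psi> (T y))"
      using oV by (intro smooth_on_compose[OF _ V' _ \<psi>] smooth_on_bounded_linear_compose[OF _ bT]
          smooth_on_id) auto
    show "f x \<in> T -` V' \<and> \<psi> (T (f x)) = x" if "x \<in> U'" for x
      using hom that by (auto simp: homeomorphism_def h_def)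
  qed (use U' oV img in auto)
qed

section \<open>Charts and coordinates of tangent vectors\<close>

definition transition_derivative ::
  "('m, 'e::euclidean_space) chart \<Rightarrow> ('m, 'e) chart \<Rightarrow> 'm \<Rightarrow> 'e \<Rightarrow> 'e" where
  "transition_derivative c d m = frechet_derivative (snd d \<circ> cinv c) (at (snd c m))"

context smooth_manifold
begin

lemma chart_at: "chart_at A p \<in> A" "p \<in> fst (chart_at A p)"
proof -
  have "\<exists>c. c \<in> A \<and> p \<in> fst c" using cover by blast
  then have "chart_at A p \<in> A \<and> p \<in> fst (chart_at A p)"
    unfolding chart_at_def by (rule someI_ex)
  then show "chart_at A p \<in> A" "p \<in> fst (chart_at A p)" by auto
qed

lemma open_chart: "c \<in> A \<Longrightarrow> open (fst c)" "c \<in> A \<Longrightarrow> open (cimage c)"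
  and continuous_chart: "c \<in> A \<Longrightarrow> continuous_on (fst c) (snd c)"
    "c \<in> A \<Longrightarrow> continuous_on (cimage c) (cinv c)"
  and cinv_chart: "c \<in> A \<Longrightarrow> m \<in> fst c \<Longrightarrow> cinv c (snd c m) = m"
  and chart_cinv: "c \<in> A \<Longrightarrow> x \<in> cimage c \<Longrightarrow> snd c (cinv c x) = x"
  and cinv_in: "c \<in> A \<Longrightarrow> x \<in> cimage c \<Longrightarrow> cinv c x \<in> fst c"
  using charts[of c] by (auto simp: is_chart_def homeomorphism_def)

lemma chart_in: "m \<in> fst c \<Longrightarrow> snd c m \<in> cimage c"
  by (simp add: cimage_def)

lemma chart_image_Int:
  assumes "c \<in> A"
  shows "snd c ` (fst c \<inter> T) = cimage c \<inter> cinv c -` T"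
proof
  show "snd c ` (fst c \<inter> T) \<subseteq> cimage c \<inter> cinv c -` T"
    using assms by (auto simp: chart_in cinv_chart)
  show "cimage c \<inter> cinv c -` T \<subseteq> snd c ` (fst c \<inter> T)"
  proof
    fix x assume "x \<in> cimage c \<inter> cinv c -` T"
    then have "cinv c x \<in> fst c \<inter> T" "x = snd c (cinv c x)"
      using assms by (auto simp: cinv_in chart_cinv)
    then show "x \<in> snd c ` (fst c \<inter> T)" by (rule rev_image_eqI)
  qed
qed

lemma open_chart_preimage: "c \<in> A \<Longrightarrow> open T \<Longrightarrow> open (cimage c \<inter> cinv c -` T)"
  by (intro continuous_open_preimage open_chart continuous_chart)

lemma eventually_chart:
  assumes "c \<in> A" "p \<in> fst c" "eventually P (nhds (snd c p))"
  shows "eventually (\<lambda>m. m \<in> fst c \<and> P (snd c m)) (nhds p)"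
proof -
  obtain T where T: "open T" "snd c p \<in> T" "\<And>x. x \<in> T \<Longrightarrow> P x"
    using assms(3) eventually_nhds by metis
  have "open (fst c \<inter> snd c -` T)"
    using T(1) assms(1) by (intro continuous_open_preimage continuous_chart open_chart)
  then show ?thesis unfolding eventually_nhds
    by (intro exI[of _ "fst c \<inter> snd c -` T"]) (use T assms in auto)
qed

lemma smooth_transition:
  "c \<in> A \<Longrightarrow> d \<in> A \<Longrightarrow> smooth_on (cimage c \<inter> cinv c -` fst d) (snd d \<circ> cinv c)"
  using compatible[of c d] chart_image_Int by metis

lemma has_derivative_transition:
  assumes "c \<in> A" "d \<in> A" "m \<in> fst c" "m \<in> fst d"
  shows "((snd d \<circ> cinv c) has_derivative transition_derivative c d m) (at (snd c m))"
  unfolding transition_derivative_def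
  by (rule smooth_on_has_derivative[OF smooth_transition[OF assms(1,2)]])
    (use assms in \<open>auto simp: cinv_chart chart_in\<close>)

lemma transition_derivative_linear:
  "\<lbrakk>c \<in> A; d \<in> A; m \<in> fst c; m \<in> fst d\<rbrakk> \<Longrightarrow> linear (transition_derivative c d m)"
  using has_derivative_transition has_derivative_linear by blast

text \<open>The chain rule for changes of charts: the cocycle property of the tangent bundle.\<close>

lemma transition_derivative_compose:
  assumes "c \<in> A" "d \<in> A" "e \<in> A" "m \<in> fst c" "m \<in> fst d" "m \<in> fst e"
  shows "transition_derivative d e m (transition_derivative c d m v) = transition_derivative c e m v"
proof -
  have de: "((snd e \<circ> cinv d) has_derivative transition_derivative d e m) (at ((snd d \<circ> cinv c) (snd c m)))"
    using has_derivative_transition[of d e m] assms by (simp add: cinv_chart)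
  have *: "((snd e \<circ> cinv d) \<circ> (snd d \<circ> cinv c) has_derivative
      transition_derivative d e m \<circ> transition_derivative c d m) (at (snd c m))"
    by (rule diff_chain_at[OF has_derivative_transition de]) (use assms in auto)
  have "(snd e \<circ> cinv c has_derivative
      transition_derivative d e m \<circ> transition_derivative c d m) (at (snd c m))"
    by (rule has_derivative_transform_within_open[OF * open_chart_preimage[of c "fst d"]])
      (use assms open_chart in \<open>auto simp: cinv_chart chart_in\<close>)
  then show ?thesis
    using has_derivative_unique[OF _ has_derivative_transition[of c e m]] assms
    by (metis comp_apply)
qed

lemma transition_derivative_refl:
  assumes "c \<in> A" "m \<in> fst c"
  shows "transition_derivative c c m v = v"
proof -
  have "(snd c \<circ> cinv c has_derivative (\<lambda>v. v)) (at (snd c m))"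
    by (rule has_derivative_transform_within_open[OF has_derivative_ident open_chart(2)])
      (use assms in \<open>auto simp: chart_cinv chart_in\<close>)
  then show ?thesis using has_derivative_unique[OF _ has_derivative_transition[of c c m]] assms by metis
qed

lemma tcoord_eq: "tcoord A c m = transition_derivative (chart_at A m) c m"
  by (simp add: tcoord_def transition_derivative_def fun_eq_iff)

lemma tcoord_linear: "c \<in> A \<Longrightarrow> m \<in> fst c \<Longrightarrow> linear (tcoord A c m)"
  unfolding tcoord_eq by (intro transition_derivative_linear chart_at)

lemma tcoord_chart_at: "tcoord A (chart_at A m) m v = v"
  unfolding tcoord_eq by (intro transition_derivative_refl chart_at)

lemma transition_tcoord:
  "\<lbrakk>c \<in> A; d \<in> A; m \<in> fst c; m \<in> fst d\<rbrakk> \<Longrightarrow>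
    transition_derivative c d m (tcoord A c m v) = tcoord A d m v"
  unfolding tcoord_eq by (intro transition_derivative_compose chart_at)

lemma transition_tcoord_inverse:
  assumes "c \<in> A" "m \<in> fst c"
  shows "transition_derivative c (chart_at A m) m (tcoord A c m v) = v"
    and "tcoord A c m (transition_derivative c (chart_at A m) m w) = w"
proof -
  show "transition_derivative c (chart_at A m) m (tcoord A c m v) = v"
    using transition_tcoord[of c "chart_at A m" m v] assms chart_at tcoord_chart_at by simp
  show "tcoord A c m (transition_derivative c (chart_at A m) m w) = w"
    unfolding tcoord_eq
    using transition_derivative_compose transition_derivative_refl assms chart_at by metis
qed

lemma tcoord_inject: "c \<in> A \<Longrightarrow> m \<in> fst c \<Longrightarrow> tcoord A c m v = tcoord A c m w \<Longrightarrow> v = w"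
  by (metis transition_tcoord_inverse(1))

section \<open>Algebra of smooth functions and vector fields\<close>

lemma smooth_fun_const: "smooth_fun A (\<lambda>p. c)"
  by (simp add: smooth_fun_def o_def smooth_on_const)

lemma smooth_fun_mult: "smooth_fun A f \<Longrightarrow> smooth_fun A g \<Longrightarrow> smooth_fun A (\<lambda>p. f p * g p)"
  using open_chart(2) by (simp add: smooth_fun_def o_def smooth_on_mult)

lemma vector_fields_zero: "(\<lambda>p. 0) \<in> vector_fields A"
proof -
  have "smooth_on (cimage c) (field_in_chart A c (\<lambda>p. 0))" if "c \<in> A" for c
    by (rule smooth_on_cong[OF open_chart(2)[OF that] _ smooth_on_const[of _ 0]])
      (use that in \<open>simp add: field_in_chart_def linear_0[OF tcoord_linear] cinv_in\<close>)
  then show ?thesis by (simp add: vector_fields_def)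
qed

lemma vector_fields_add:
  assumes "X \<in> vector_fields A" "Y \<in> vector_fields A"
  shows "(\<lambda>p. X p + Y p) \<in> vector_fields A"
proof -
  have "smooth_on (cimage c) (field_in_chart A c (\<lambda>p. X p + Y p))" if "c \<in> A" for c
  proof (rule smooth_on_cong[OF open_chart(2)[OF that] _ smooth_on_add[OF open_chart(2)[OF that]]])
    show "smooth_on (cimage c) (field_in_chart A c X)" "smooth_on (cimage c) (field_in_chart A c Y)"
      using assms that by (auto simp: vector_fields_def)
  qed (use that in \<open>simp add: field_in_chart_def linear_add[OF tcoord_linear] cinv_in\<close>)
  then show ?thesis by (simp add: vector_fields_def)
qed

lemma vector_fields_scale:
  assumes "smooth_fun A f" "Y \<in> vector_fields A"
  shows "(\<lambda>p. f p *\<^sub>R Y p) \<in> vector_fields A"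
proof -
  have "smooth_on (cimage c) (field_in_chart A c (\<lambda>p. f p *\<^sub>R Y p))" if "c \<in> A" for c
  proof (rule smooth_on_cong[OF open_chart(2)[OF that] _ smooth_on_scaleR[OF open_chart(2)[OF that]]])
    show "smooth_on (cimage c) (f \<circ> cinv c)" "smooth_on (cimage c) (field_in_chart A c Y)"
      using assms that by (auto simp: vector_fields_def smooth_fun_def)
  qed (use that in \<open>simp add: field_in_chart_def linear_cmul[OF tcoord_linear] cinv_in\<close>)
  then show ?thesis by (simp add: vector_fields_def)
qed

lemma vector_fields_diff:
  "X \<in> vector_fields A \<Longrightarrow> Y \<in> vector_fields A \<Longrightarrow> (\<lambda>p. X p - Y p) \<in> vector_fields A"
  using vector_fields_add[of X "\<lambda>p. (-1) *\<^sub>R Y p"] vector_fields_scale[OF smooth_fun_const[of "-1"], of Y]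
  by simp

lemma vector_fields_sum:
  "(\<And>i. i \<in> I \<Longrightarrow> E i \<in> vector_fields A) \<Longrightarrow> (\<lambda>p. \<Sum>i\<in>I. E i p) \<in> vector_fields A"
  by (induction I rule: infinite_finite_induct) (auto intro: vector_fields_zero vector_fields_add)

section \<open>Functions and vector fields supported in a chart\<close>

text \<open>Functions and fields given in the coordinates of one chart, extended by zero. The extension
  is smooth when the data have compact support inside the chart: compact sets are closed in a
  Hausdorff space, so a point outside the chart has a neighbourhood on which the extension is zero.\<close>

definition chart_function :: "('m, 'e) chart \<Rightarrow> ('e \<Rightarrow> real) \<Rightarrow> 'm \<Rightarrow> real" where
  "chart_function c f m = (if m \<in> fst c then f (snd c m) else 0)"

definition chart_field :: "('m, 'e) chart \<Rightarrow> ('e \<Rightarrow> 'e) \<Rightarrow> 'm \<Rightarrow> 'e" where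
  "chart_field c w m =
     (if m \<in> fst c then transition_derivative c (chart_at A m) m (w (snd c m)) else 0)"

lemma tcoord_chart_field:
  "c \<in> A \<Longrightarrow> m \<in> fst c \<Longrightarrow> tcoord A c m (chart_field c w m) = w (snd c m)"
  by (simp add: chart_field_def transition_tcoord_inverse)

lemma open_away_from_support:
  assumes "c \<in> A" "d \<in> A" "compact K" "K \<subseteq> cimage c"
  shows "open (cimage d \<inter> cinv d -` (- (cinv c ` K)))"
proof -
  have "compact (cinv c ` K)"
    using assms continuous_chart(2) compact_continuous_image continuous_on_subset by blast
  then have "closed (cinv c ` K)" by (rule compact_imp_closed)
  then show ?thesis using assms(2) open_chart_preimage by (simp add: open_Compl)
qed

lemma smooth_chart_function:
  assumes c: "c \<in> A" and f: "smooth_on UNIV f" and K: "compact K" "K \<subseteq> cimage c"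
    and supp: "\<And>x. x \<notin> K \<Longrightarrow> f x = 0"
  shows "smooth_fun A (chart_function c f)"
  unfolding smooth_fun_def
proof (intro ballI smooth_on_local open_chart)
  fix d x assume d: "d \<in> A" and x: "x \<in> cimage d"
  show "\<exists>T. open T \<and> x \<in> T \<and> smooth_on T (chart_function c f \<circ> cinv d)"
  proof (cases "cinv d x \<in> fst c")
    case True
    let ?T = "cimage d \<inter> cinv d -` fst c"
    have T: "open ?T" using d c by (simp add: open_chart_preimage open_chart)
    have "smooth_on ?T (\<lambda>y. f ((snd c \<circ> cinv d) y))"
      by (rule smooth_on_compose[OF T open_UNIV smooth_transition[OF d c] f]) simp
    then have "smooth_on ?T (chart_function c f \<circ> cinv d)"
      by (rule smooth_on_cong[OF T, rotated]) (simp add: chart_function_def)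
    then show ?thesis using T x True by blast
  next
    case False
    let ?T = "cimage d \<inter> cinv d -` (- (cinv c ` K))"
    have "smooth_on ?T (chart_function c f \<circ> cinv d)"
      by (rule smooth_on_cong[OF open_away_from_support[OF c d K] _ smooth_on_const[of _ 0]])
        (use supp c in \<open>auto simp: chart_function_def image_iff cinv_chart\<close>,
         metis cinv_chart supp c)
    moreover have "x \<in> ?T" using x False K(2) cinv_in[OF c] by auto
    ultimately show ?thesis using open_away_from_support[OF c d K] by blast
  qed
qed

lemma smooth_chart_field:
  assumes c: "c \<in> A" and w: "smooth_on UNIV w" and K: "compact K" "K \<subseteq> cimage c"
    and supp: "\<And>x. x \<notin> K \<Longrightarrow> w x = 0"
  shows "chart_field c w \<in> vector_fields A"
  unfolding vector_fields_def
proof (intro CollectI ballI smooth_on_local open_chart)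
  fix d x assume d: "d \<in> A" and x: "x \<in> cimage d"
  show "\<exists>T. open T \<and> x \<in> T \<and> smooth_on T (field_in_chart A d (chart_field c w))"
  proof (cases "cinv d x \<in> fst c")
    case True
    let ?T = "cimage d \<inter> cinv d -` fst c" and ?R = "cimage c \<inter> cinv c -` fst d"
    have T: "open ?T" and R: "open ?R" using d c by (simp_all add: open_chart_preimage open_chart)
    have "smooth_on ?R (\<lambda>z. frechet_derivative (snd d \<circ> cinv c) (at z) (w z))"
      using smooth_on_subset[OF w] by (intro smooth_on_derivative_apply[OF R] smooth_transition c d) auto
    then have "smooth_on ?T (\<lambda>y. frechet_derivative (snd d \<circ> cinv c) (at ((snd c \<circ> cinv d) y))
        (w ((snd c \<circ> cinv d) y)))"
      by (rule smooth_on_compose[OF T R smooth_transition[OF d c]])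
        (use c d in \<open>auto simp: chart_in cinv_chart cinv_in\<close>)
    then have "smooth_on ?T (field_in_chart A d (chart_field c w))"
    proof (rule smooth_on_cong[OF T, rotated])
      fix y assume y: "y \<in> ?T"
      have "field_in_chart A d (chart_field c w) y
          = transition_derivative c d (cinv d y) (tcoord A c (cinv d y) (chart_field c w (cinv d y)))"
        using y c d by (simp add: field_in_chart_def transition_tcoord cinv_in)
      then show "frechet_derivative (snd d \<circ> cinv c) (at ((snd c \<circ> cinv d) y)) (w ((snd c \<circ> cinv d) y))
          = field_in_chart A d (chart_field c w) y"
        using y c d by (simp add: tcoord_chart_field transition_derivative_def)
    qed
    then show ?thesis using T x True by blast
  next
    case False
    let ?T = "cimage d \<inter> cinv d -` (- (cinv c ` K))"
    have z: "chart_field c w (cinv d y) = 0" if "y \<in> ?T" for y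
    proof (cases "cinv d y \<in> fst c")
      case True
      then have "snd c (cinv d y) \<notin> K"
        using that by (metis c cinv_chart ComplD Int_iff imageI vimageD)
      then show ?thesis
        using supp linear_0[OF transition_derivative_linear[OF c chart_at(1) True chart_at(2)]]
        by (simp add: chart_field_def)
    qed (simp add: chart_field_def)
    have "smooth_on ?T (field_in_chart A d (chart_field c w))"
      by (rule smooth_on_cong[OF open_away_from_support[OF c d K] _ smooth_on_const[of _ 0]])
        (use z d in \<open>auto simp: field_in_chart_def cinv_in linear_0[OF tcoord_linear]\<close>)
    moreover have "x \<in> ?T" using x False K(2) cinv_in[OF c] by auto
    ultimately show ?thesis using open_away_from_support[OF c d K] by blast
  qed
qed

end

lemma smooth_on_cutoff:
  assumes "smooth_on UNIV \<phi>" "compact K" "K \<subseteq> U" "\<And>x. x \<notin> K \<Longrightarrow> \<phi> x = 0" "open U" "smooth_on U w"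
  shows "smooth_on UNIV (\<lambda>x. \<phi> x *\<^sub>R w x)"
proof (rule smooth_on_local[OF open_UNIV])
  fix x
  show "\<exists>T. open T \<and> x \<in> T \<and> smooth_on T (\<lambda>x. \<phi> x *\<^sub>R w x)"
  proof (cases "x \<in> K")
    case True
    have "smooth_on U (\<lambda>x. \<phi> x *\<^sub>R w x)"
      using assms smooth_on_subset by (intro smooth_on_scaleR) blast+
    then show ?thesis using True assms by blast
  next
    case False
    have o: "open (- K)" using assms(2) by (simp add: compact_imp_closed open_Compl)
    have "smooth_on (- K) (\<lambda>x. \<phi> x *\<^sub>R w x)"
      by (rule smooth_on_cong[OF o _ smooth_on_const[of _ 0]]) (simp add: assms(4))
    then show ?thesis using False o by blast
  qed
qed

context smooth_manifold
begin

lemma exists_function_in_chart: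
  assumes "c \<in> A" "p \<in> fst c" "open U" "snd c p \<in> U" "U \<subseteq> cimage c" "smooth_on U f"
  shows "\<exists>F. smooth_fun A F \<and> (\<forall>\<^sub>F m in nhds p. F m = f (snd c m))"
proof -
  obtain \<phi> K where \<phi>: "smooth_on UNIV \<phi>" "compact K" "K \<subseteq> U" "\<And>x. x \<notin> K \<Longrightarrow> \<phi> x = (0::real)"
    "eventually (\<lambda>x. \<phi> x = 1) (nhds (snd c p))"
    using smooth_bump[OF assms(3,4)] by metis
  have "smooth_fun A (chart_function c (\<lambda>x. \<phi> x *\<^sub>R f x))"
    by (rule smooth_chart_function[OF assms(1) smooth_on_cutoff[OF \<phi>(1-4) assms(3,6)] \<phi>(2)])
      (use assms \<phi> in auto)
  moreover have "\<forall>\<^sub>F m in nhds p. chart_function c (\<lambda>x. \<phi> x *\<^sub>R f x) m = f (snd c m)"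
    using eventually_chart[OF assms(1,2) \<phi>(5)] by eventually_elim (simp add: chart_function_def)
  ultimately show ?thesis by blast
qed

lemma exists_field_in_chart:
  assumes "c \<in> A" "p \<in> fst c" "open U" "snd c p \<in> U" "U \<subseteq> cimage c" "smooth_on U w"
  shows "\<exists>W\<in>vector_fields A. \<forall>\<^sub>F m in nhds p. tcoord A c m (W m) = w (snd c m)"
proof -
  obtain \<phi> K where \<phi>: "smooth_on UNIV \<phi>" "compact K" "K \<subseteq> U" "\<And>x. x \<notin> K \<Longrightarrow> \<phi> x = (0::real)"
    "eventually (\<lambda>x. \<phi> x = 1) (nhds (snd c p))"
    using smooth_bump[OF assms(3,4)] by metis
  have "chart_field c (\<lambda>x. \<phi> x *\<^sub>R w x) \<in> vector_fields A"
    by (rule smooth_chart_field[OF assms(1) smooth_on_cutoff[OF \<phi>(1-4) assms(3,6)] \<phi>(2)])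
      (use assms \<phi> in auto)
  moreover have "\<forall>\<^sub>F m in nhds p. tcoord A c m (chart_field c (\<lambda>x. \<phi> x *\<^sub>R w x) m) = w (snd c m)"
    using eventually_chart[OF assms(1,2) \<phi>(5)] by eventually_elim (simp add: tcoord_chart_field assms(1))
  ultimately show ?thesis by blast
qed

lemma smooth_fun_local_inverse:
  assumes f: "smooth_fun A f" and "f p \<noteq> 0"
  shows "\<exists>d. smooth_fun A d \<and> (\<forall>\<^sub>F m in nhds p. d m * f m = 1)"
proof -
  define c where "c = chart_at A p"
  have c: "c \<in> A" "p \<in> fst c" using chart_at by (auto simp: c_def)
  define U where "U = cimage c \<inter> (f \<circ> cinv c) -` (- {0})"
  have s: "smooth_on (cimage c) (f \<circ> cinv c)" using f c by (simp add: smooth_fun_def)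
  have U: "open U" unfolding U_def
    by (intro continuous_open_preimage smooth_on_continuous[OF s] open_chart c) auto
  have p: "snd c p \<in> U" using assms(2) c by (simp add: U_def chart_in cinv_chart)
  have "smooth_on U (\<lambda>x. inverse ((f \<circ> cinv c) x))"
    by (rule smooth_on_inverse[OF U smooth_on_subset[OF s]]) (auto simp: U_def)
  then obtain d where d: "smooth_fun A d" "\<forall>\<^sub>F m in nhds p. d m = inverse ((f \<circ> cinv c) (snd c m))"
    using exists_function_in_chart[OF c U p] by (auto simp: U_def)
  have "\<forall>\<^sub>F x in nhds (snd c p). x \<in> U" using U p eventually_nhds by blast
  from eventually_chart[OF c this] d(2)
  have "\<forall>\<^sub>F m in nhds p. d m * f m = 1"
    by eventually_elim (use c in \<open>auto simp: U_def cinv_chart\<close>)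
  then show ?thesis using d by blast
qed

text \<open>Near \<open>p\<close> a field is a combination of coordinate fields. Coefficients and coordinate fields are
  both multiplied by the same bump function, so that all objects are global, and the square \<open>f\<close> of
  the bump function appears in front of \<open>X\<close>. The last property lets the zeros of the field pass to
  the coefficients, which is what the locality of connections needs.\<close>

lemma local_expansion:
  assumes X: "X \<in> vector_fields A"
  obtains f F E where "smooth_fun A f" "f p = 1" "\<And>i. smooth_fun A (F i)" "\<And>i. E i \<in> vector_fields A"
    "\<And>m. f m *\<^sub>R X m = (\<Sum>i\<in>(Basis::'e set). F i m *\<^sub>R E i m)"
    "\<And>i m. X m = 0 \<Longrightarrow> F i m = 0"
proof -
  define c where "c = chart_at A p"
  have c: "c \<in> A" "p \<in> fst c" using chart_at by (auto simp: c_def)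
  obtain \<phi> K where \<phi>: "smooth_on UNIV \<phi>" "compact K" "K \<subseteq> cimage c" "\<And>x. x \<notin> K \<Longrightarrow> \<phi> x = (0::real)"
    "\<phi> (snd c p) = 1"
    using smooth_bump[OF open_chart(2)[OF c(1)] chart_in[OF c(2)]] by metis
  have cut_fun: "smooth_on UNIV (\<lambda>x. \<phi> x *\<^sub>R h x)" if "smooth_on (cimage c) h" for h :: "'e \<Rightarrow> real"
    by (rule smooth_on_cutoff[OF \<phi>(1-3) _ open_chart(2)[OF c(1)] that]) (rule \<phi>(4))
  have cut_field: "smooth_on UNIV (\<lambda>x. \<phi> x *\<^sub>R i)" for i :: 'e
    by (rule smooth_on_scaleR[OF open_UNIV \<phi>(1) smooth_on_const])
  define f where "f = chart_function c (\<lambda>x. \<phi> x * \<phi> x)"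
  define F where "F i = chart_function c (\<lambda>x. \<phi> x *\<^sub>R (field_in_chart A c X x \<bullet> i))" for i
  define E where "E i = chart_field c (\<lambda>x. \<phi> x *\<^sub>R i)" for i
  have Xc: "smooth_on (cimage c) (field_in_chart A c X)" using X c by (simp add: vector_fields_def)
  have 1: "smooth_fun A f" unfolding f_def
    by (rule smooth_chart_function[OF c(1) smooth_on_mult[OF open_UNIV \<phi>(1) \<phi>(1)] \<phi>(2,3)])
      (simp add: \<phi>(4))
  have 2: "f p = 1" using c \<phi>(5) by (simp add: f_def chart_function_def)
  have 3: "smooth_fun A (F i)" for i unfolding F_def
    by (rule smooth_chart_function[OF c(1) cut_fun[OF smooth_on_inner[OF open_chart(2)[OF c(1)] Xc smooth_on_const]] \<phi>(2,3)])
      (simp add: \<phi>(4))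
  have 4: "E i \<in> vector_fields A" for i unfolding E_def
    by (rule smooth_chart_field[OF c(1) cut_field \<phi>(2,3)]) (simp add: \<phi>(4))
  have 5: "f m *\<^sub>R X m = (\<Sum>i\<in>Basis. F i m *\<^sub>R E i m)" for m
  proof (cases "m \<in> fst c")
    case True
    let ?t = "transition_derivative c (chart_at A m) m"
    have lin: "linear ?t" using transition_derivative_linear c True chart_at by blast
    have Xm: "field_in_chart A c X (snd c m) = tcoord A c m (X m)"
      using c True by (simp add: field_in_chart_def cinv_chart)
    have "(\<Sum>i\<in>Basis. F i m *\<^sub>R E i m) = (\<phi> (snd c m) * \<phi> (snd c m)) *\<^sub>R (\<Sum>i\<in>Basis. (tcoord A c m (X m) \<bullet> i) *\<^sub>R ?t i)"
      using True Xm by (simp add: F_def E_def chart_function_def chart_field_def linear_cmul[OF lin] scaleR_sum_right mult_ac)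
    also have "\<dots> = f m *\<^sub>R ?t (tcoord A c m (X m))"
      using True linear_basis_expansion[OF lin, of "tcoord A c m (X m)"]
      by (simp add: f_def chart_function_def)
    finally show ?thesis using transition_tcoord_inverse(1)[OF c(1) True] by simp
  qed (simp add: f_def F_def chart_function_def)
  have 6: "F i m = 0" if "X m = 0" for i m
    using that c by (simp add: F_def chart_function_def field_in_chart_def cinv_chart linear_0[OF tcoord_linear])
  show thesis by (rule that[OF 1 2 3 4 5 6])
qed

end

section \<open>Locality of affine connections\<close>

context affine_connection
begin

lemma conn_sum_left:
  assumes "finite I" "\<And>i. smooth_fun A (F i)" "\<And>i. E i \<in> vector_fields A" "W \<in> vector_fields A"
  shows "nab (\<lambda>m. \<Sum>i\<in>I. F i m *\<^sub>R E i m) W p = (\<Sum>i\<in>I. F i p *\<^sub>R nab (E i) W p)"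
  using assms(1)
proof induction
  case empty
  show ?case using conn_scale_left[OF smooth_fun_const[of 0] assms(4,4)] by (simp add: fun_eq_iff)
next
  case (insert i I)
  have "nab (\<lambda>m. F i m *\<^sub>R E i m + (\<Sum>i\<in>I. F i m *\<^sub>R E i m)) W p
      = nab (\<lambda>m. F i m *\<^sub>R E i m) W p + nab (\<lambda>m. \<Sum>i\<in>I. F i m *\<^sub>R E i m) W p"
    using conn_add_left[of "\<lambda>m. F i m *\<^sub>R E i m" "\<lambda>m. \<Sum>i\<in>I. F i m *\<^sub>R E i m" W] assms
    by (simp add: vector_fields_scale vector_fields_sum)
  then show ?case using insert conn_scale_left[OF assms(2,3,4)] by simp
qed

text \<open>A connection is tensorial in its first argument: all coefficients in a local expansion of \<open>Z\<close>
  vanish at \<open>p\<close>. Since \<open>f p = 1\<close>, passing from \<open>Z\<close> to \<open>f Z\<close> is harmless.\<close>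

lemma conn_vanish_left:
  assumes "Z \<in> vector_fields A" "W \<in> vector_fields A" "Z p = 0"
  shows "nab Z W p = 0"
proof -
  obtain f F E where e: "smooth_fun A f" "f p = 1" "\<And>i. smooth_fun A (F i)" "\<And>i. E i \<in> vector_fields A"
    "\<And>m. f m *\<^sub>R Z m = (\<Sum>i\<in>(Basis::'e set). F i m *\<^sub>R E i m)" "\<And>i m. Z m = 0 \<Longrightarrow> F i m = 0"
    using local_expansion[OF assms(1)] by blast
  have "nab Z W p = nab (\<lambda>m. f m *\<^sub>R Z m) W p"
    using conn_scale_left[OF e(1) assms(1,2)] e(2) by simp
  also have "\<dots> = (\<Sum>i\<in>Basis. F i p *\<^sub>R nab (E i) W p)"
    unfolding e(5) by (rule conn_sum_left[OF finite_Basis e(3,4) assms(2)])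
  finally show ?thesis using e(6) assms(3) by simp
qed

lemma conn_cong_left:
  assumes "Z \<in> vector_fields A" "Z' \<in> vector_fields A" "W \<in> vector_fields A" "Z p = Z' p"
  shows "nab Z W p = nab Z' W p"
proof -
  have D: "(\<lambda>m. Z m - Z' m) \<in> vector_fields A" using assms vector_fields_diff by blast
  have "nab Z W p = nab (\<lambda>m. Z m - Z' m) W p + nab Z' W p"
    using conn_add_left[OF D assms(2,3)] by simp
  then show ?thesis using conn_vanish_left[OF D assms(3)] assms(4) by simp
qed

lemma conn_sum_right:
  assumes "finite I" "\<And>i. smooth_fun A (F i)" "\<And>i. E i \<in> vector_fields A" "Z \<in> vector_fields A"
  shows "nab Z (\<lambda>m. \<Sum>i\<in>I. F i m *\<^sub>R E i m) p
    = (\<Sum>i\<in>I. dir_deriv A Z (F i) p *\<^sub>R E i p + F i p *\<^sub>R nab Z (E i) p)"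
  using assms(1)
proof induction
  case empty
  have "dir_deriv A Z (\<lambda>_. 0) p = 0" by (simp add: dir_deriv_def o_def)
  then show ?case
    using conn_leibniz[OF smooth_fun_const[of 0] assms(4,4)] by (simp add: fun_eq_iff)
next
  case (insert i I)
  have "nab Z (\<lambda>m. F i m *\<^sub>R E i m + (\<Sum>i\<in>I. F i m *\<^sub>R E i m)) p
      = nab Z (\<lambda>m. F i m *\<^sub>R E i m) p + nab Z (\<lambda>m. \<Sum>i\<in>I. F i m *\<^sub>R E i m) p"
    using conn_add_right[of Z "\<lambda>m. F i m *\<^sub>R E i m" "\<lambda>m. \<Sum>i\<in>I. F i m *\<^sub>R E i m"] assms
    by (simp add: vector_fields_scale vector_fields_sum)
  then show ?case using insert conn_leibniz[OF assms(2,4,3)] by simp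
qed

text \<open>By the Leibniz rule, the derivative at a zero of \<open>D\<close> only sees the derivatives of the coefficients
  of \<open>D\<close>, and these coefficients vanish wherever \<open>D\<close> does. For a field that vanishes along a
  submanifold and a direction tangent to it, the hypothesis on \<open>dir_deriv\<close> is satisfied.\<close>

lemma conn_vanish_right:
  assumes "Z \<in> vector_fields A" "D \<in> vector_fields A" "D p = 0"
    and dir: "\<And>F. smooth_fun A F \<Longrightarrow> (\<And>m. D m = 0 \<Longrightarrow> F m = 0) \<Longrightarrow> dir_deriv A Z F p = 0"
  shows "nab Z D p = 0"
proof -
  obtain f F E where e: "smooth_fun A f" "f p = 1" "\<And>i. smooth_fun A (F i)" "\<And>i. E i \<in> vector_fields A"
    "\<And>m. f m *\<^sub>R D m = (\<Sum>i\<in>(Basis::'e set). F i m *\<^sub>R E i m)" "\<And>i m. D m = 0 \<Longrightarrow> F i m = 0"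
    using local_expansion[OF assms(2)] by blast
  have "nab Z D p = nab Z (\<lambda>m. f m *\<^sub>R D m) p"
    using conn_leibniz[OF e(1) assms(1,2)] e(2) assms(3) by simp
  also have "\<dots> = (\<Sum>i\<in>Basis. dir_deriv A Z (F i) p *\<^sub>R E i p + F i p *\<^sub>R nab Z (E i) p)"
    unfolding e(5) by (rule conn_sum_right[OF finite_Basis e(3,4) assms(1)])
  also have "\<dots> = 0" using e(6) assms(3) dir[OF e(3)] by simp
  finally show ?thesis .
qed

end

section \<open>Coordinates of an immersion\<close>

context isometric_immersion
begin

lemma continuous_immersion: "continuous_on UNIV \<iota>"
  using immersion_smooth by (simp add: smooth_map_def)

lemma open_immersion_preimage: "open T \<Longrightarrow> open (\<iota> -` T)"
  using continuous_on_open_vimage[of UNIV \<iota>] continuous_immersion by auto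

lemma eventually_immersion:
  assumes "eventually P (nhds (\<iota> q))"
  shows "eventually (\<lambda>r. P (\<iota> r)) (nhds q)"
  using assms open_immersion_preimage unfolding eventually_nhds by (metis vimageE vimageI)

definition coord_domain :: "('n, 'd) chart \<Rightarrow> ('m, 'e) chart \<Rightarrow> 'd set" where
  "coord_domain b c = cimage b \<inter> cinv b -` (\<iota> -` fst c)"

definition coord_map :: "('n, 'd) chart \<Rightarrow> ('m, 'e) chart \<Rightarrow> 'd \<Rightarrow> 'e" where
  "coord_map b c = snd c \<circ> \<iota> \<circ> cinv b"

lemma open_coord_domain: "b \<in> B \<Longrightarrow> c \<in> A \<Longrightarrow> open (coord_domain b c)"
  unfolding coord_domain_def
  by (intro sub.open_chart_preimage open_immersion_preimage ambient.open_chart)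

lemma smooth_coord_map: "b \<in> B \<Longrightarrow> c \<in> A \<Longrightarrow> smooth_on (coord_domain b c) (coord_map b c)"
  using immersion_smooth sub.chart_image_Int
  unfolding smooth_map_def coord_domain_def coord_map_def by metis

lemma in_coord_domain:
  "b \<in> B \<Longrightarrow> r \<in> fst b \<Longrightarrow> \<iota> r \<in> fst c \<Longrightarrow> snd b r \<in> coord_domain b c"
  by (simp add: coord_domain_def sub.chart_in sub.cinv_chart)

lemma coord_map_chart: "b \<in> B \<Longrightarrow> r \<in> fst b \<Longrightarrow> coord_map b c (snd b r) = snd c (\<iota> r)"
  by (simp add: coord_map_def sub.cinv_chart)

lemma has_derivative_coord_map:
  "\<lbrakk>b \<in> B; c \<in> A; r \<in> fst b; \<iota> r \<in> fst c\<rbrakk> \<Longrightarrow>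
    (coord_map b c has_derivative frechet_derivative (coord_map b c) (at (snd b r))) (at (snd b r))"
  by (rule smooth_on_has_derivative[OF smooth_coord_map in_coord_domain])

lemma differential_eq:
  "differential B A \<iota> r = frechet_derivative (coord_map (chart_at B r) (chart_at A (\<iota> r))) (at (snd (chart_at B r) r))"
  by (simp add: differential_def coord_map_def fun_eq_iff)

lemma linear_differential: "linear (differential B A \<iota> r)"
  unfolding differential_eq
  by (rule has_derivative_linear[OF has_derivative_coord_map])
    (simp_all add: sub.chart_at ambient.chart_at)

text \<open>The differential is defined with the chosen charts at \<open>r\<close> and \<open>\<iota> r\<close>, which change with \<open>r\<close> without any
  continuity. In a fixed pair of charts it is the derivative of one and the same map, by the chain
  rule for the two ways of composing the changes of charts with the immersion.\<close>

lemma tcoord_differential: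
  assumes "b \<in> B" "c \<in> A" "r \<in> fst b" "\<iota> r \<in> fst c"
  shows "tcoord A c (\<iota> r) (differential B A \<iota> r v)
    = frechet_derivative (coord_map b c) (at (snd b r)) (tcoord B b r v)"
proof -
  define b' where "b' = chart_at B r"
  define c' where "c' = chart_at A (\<iota> r)"
  have b': "b' \<in> B" "r \<in> fst b'" and c': "c' \<in> A" "\<iota> r \<in> fst c'"
    by (auto simp: b'_def c'_def sub.chart_at ambient.chart_at)
  let ?x = "snd b' r"
  let ?T = "coord_domain b' c \<inter> coord_domain b' c' \<inter> (cimage b' \<inter> cinv b' -` fst b)"
  have T: "open ?T" "?x \<in> ?T"
    using assms b' c'
    by (auto intro!: open_Int sub.open_chart(1) open_coord_domain sub.open_chart_preimage in_coord_domain
        simp: sub.chart_in sub.cinv_chart)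
  have 1: "(snd c \<circ> cinv c' has_derivative transition_derivative c' c (\<iota> r)) (at (coord_map b' c' ?x))"
    using ambient.has_derivative_transition[OF c'(1) assms(2) c'(2) assms(4)] coord_map_chart[OF b'] by simp
  have 2: "(coord_map b c has_derivative frechet_derivative (coord_map b c) (at (snd b r)))
      (at ((snd b \<circ> cinv b') ?x))"
    using has_derivative_coord_map[OF assms] b' by (simp add: sub.cinv_chart)
  have "((snd c \<circ> cinv c') \<circ> coord_map b' c' has_derivative
      transition_derivative c' c (\<iota> r) \<circ> frechet_derivative (coord_map b' c') (at ?x)) (at ?x)"
    by (rule diff_chain_at[OF has_derivative_coord_map[OF b'(1) c'(1) b'(2) c'(2)] 1])
  then have L: "(coord_map b' c has_derivative
      transition_derivative c' c (\<iota> r) \<circ> frechet_derivative (coord_map b' c') (at ?x)) (at ?x)"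
    by (rule has_derivative_transform_within_open[OF _ T])
      (use c' in \<open>auto simp: coord_map_def coord_domain_def ambient.cinv_chart\<close>)
  have "(coord_map b c \<circ> (snd b \<circ> cinv b') has_derivative
      frechet_derivative (coord_map b c) (at (snd b r)) \<circ> transition_derivative b' b r) (at ?x)"
    by (rule diff_chain_at[OF sub.has_derivative_transition[OF b'(1) assms(1) b'(2) assms(3)] 2])
  then have R: "(coord_map b' c has_derivative
      frechet_derivative (coord_map b c) (at (snd b r)) \<circ> transition_derivative b' b r) (at ?x)"
    by (rule has_derivative_transform_within_open[OF _ T])
      (use assms in \<open>auto simp: coord_map_def sub.cinv_chart\<close>)
  from fun_cong[OF has_derivative_unique[OF L R], of v] show ?thesis
    unfolding ambient.tcoord_eq sub.tcoord_eq differential_eq b'_def c'_def comp_apply .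
qed

lemma dir_deriv_vanishing_along:
  assumes F: "smooth_fun A F" and "\<forall>\<^sub>F r in nhds q. F (\<iota> r) = 0"
    and Z: "Z (\<iota> q) = differential B A \<iota> q v"
  shows "dir_deriv A Z F (\<iota> q) = 0"
proof -
  define b where "b = chart_at B q"
  define c where "c = chart_at A (\<iota> q)"
  have b: "b \<in> B" "q \<in> fst b" and c: "c \<in> A" "\<iota> q \<in> fst c"
    by (auto simp: b_def c_def sub.chart_at ambient.chart_at)
  obtain N where N: "open N" "q \<in> N" "\<And>r. r \<in> N \<Longrightarrow> F (\<iota> r) = 0"
    using assms(2) unfolding eventually_nhds by blast
  let ?T = "coord_domain b c \<inter> (cimage b \<inter> cinv b -` N)"
  have T: "open ?T" "snd b q \<in> ?T"
    using b c N by (auto intro!: open_Int open_coord_domain sub.open_chart_preimage in_coord_domain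
        simp: sub.chart_in sub.cinv_chart)
  let ?DF = "frechet_derivative (F \<circ> cinv c) (at (snd c (\<iota> q)))"
  have "(F \<circ> cinv c has_derivative ?DF) (at (snd c (\<iota> q)))"
    using F c by (auto simp: smooth_fun_def ambient.chart_in intro!: smooth_on_has_derivative[of "cimage c"])
  then have "(F \<circ> cinv c has_derivative ?DF) (at (coord_map b c (snd b q)))"
    using coord_map_chart[OF b] by simp
  from diff_chain_at[OF has_derivative_coord_map[OF b(1) c(1) b(2) c(2)] this]
  have "((F \<circ> cinv c) \<circ> coord_map b c has_derivative
      ?DF \<circ> frechet_derivative (coord_map b c) (at (snd b q))) (at (snd b q))" .
  moreover have "((F \<circ> cinv c) \<circ> coord_map b c has_derivative (\<lambda>_. 0)) (at (snd b q))"
    by (rule has_derivative_transform_within_open[OF has_derivative_const[of 0] T])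
      (use c N in \<open>auto simp: coord_map_def coord_domain_def ambient.cinv_chart\<close>)
  ultimately have "?DF \<circ> frechet_derivative (coord_map b c) (at (snd b q)) = (\<lambda>_. 0)"
    by (rule has_derivative_unique)
  then show ?thesis
    using Z by (auto simp: dir_deriv_def differential_eq b_def c_def dest: fun_cong[of _ _ v])
qed

text \<open>The covariant derivative along the immersion does not depend on the chosen extensions: two
  extensions of \<open>V\<close> differ by a field \<open>D\<close> that vanishes along the immersion near \<open>q\<close>, and \<open>Z\<close> is tangent
  to the immersion at \<open>q\<close>; two extensions of \<open>X\<close> agree at \<open>\<iota> q\<close>.\<close>

lemma conn_along_eq:
  assumes "affine_connection A nab"
    and Z: "extends_near A \<iota> (push_field A B \<iota> X) q Z" and W: "extends_near A \<iota> V q W"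
  shows "conn_along A B \<iota> nab X V q = nab Z W (\<iota> q)"
proof -
  interpret affine_connection A nab by fact
  have uniq: "nab Z' W' (\<iota> q) = nab Z W (\<iota> q)"
    if Z': "extends_near A \<iota> (push_field A B \<iota> X) q Z'" and W': "extends_near A \<iota> V q W'" for Z' W'
  proof -
    have vf: "Z \<in> vector_fields A" "W \<in> vector_fields A" "Z' \<in> vector_fields A" "W' \<in> vector_fields A"
      using Z W Z' W' by (auto simp: extends_near_def)
    have Zq: "Z (\<iota> q) = push_field A B \<iota> X q" "Z' (\<iota> q) = push_field A B \<iota> X q"
      using Z Z' unfolding extends_near_def by (blast dest: eventually_nhds_x_imp_x)+
    define D where "D m = W' m - W m" for m
    have D: "D \<in> vector_fields A" using vf ambient.vector_fields_diff by (simp add: D_def[abs_def])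
    have "\<forall>\<^sub>F r in nhds q. W (\<iota> r) = V r" "\<forall>\<^sub>F r in nhds q. W' (\<iota> r) = V r"
      using W W' by (simp_all add: extends_near_def)
    then have ev: "\<forall>\<^sub>F r in nhds q. D (\<iota> r) = 0"
      by eventually_elim (simp add: D_def)
    have "nab Z D (\<iota> q) = 0"
    proof (rule conn_vanish_right[OF vf(1) D])
      show "D (\<iota> q) = 0" using ev eventually_nhds_x_imp_x by blast
      fix F assume F: "smooth_fun A F" "\<And>m. D m = 0 \<Longrightarrow> F m = 0"
      have "\<forall>\<^sub>F r in nhds q. F (\<iota> r) = 0" using ev by eventually_elim (rule F(2))
      then show "dir_deriv A Z F (\<iota> q) = 0"
        using dir_deriv_vanishing_along[OF F(1)] Zq(1) unfolding push_field_def by blast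
    qed
    moreover have "nab Z W' (\<iota> q) = nab Z W (\<iota> q) + nab Z D (\<iota> q)"
      using conn_add_right[OF vf(1,2) D] by (simp add: D_def)
    moreover have "nab Z' W' (\<iota> q) = nab Z W' (\<iota> q)"
      using conn_cong_left[OF vf(3,1,4)] Zq by simp
    ultimately show ?thesis by simp
  qed
  show ?thesis unfolding conn_along_def
    by (rule the_equality) (use Z W uniq in blast)+
qed

section \<open>Tangential and normal parts\<close>

lemma tan_part_unique:
  assumes "\<And>u. g (\<iota> q) (w - differential B A \<iota> q v) (differential B A \<iota> q u) = 0"
  shows "tan_part A g B \<iota> q w = v"
  unfolding tan_part_def
proof (rule the_equality)
  show "\<forall>u. g (\<iota> q) (w - differential B A \<iota> q v) (differential B A \<iota> q u) = 0" using assms by blast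
next
  fix v' assume v': "\<forall>u. g (\<iota> q) (w - differential B A \<iota> q v') (differential B A \<iota> q u) = 0"
  let ?d = "differential B A \<iota> q"
  have "g (\<iota> q) (?d (v' - v)) (?d (v' - v))
      = g (\<iota> q) ((w - ?d v) - (w - ?d v')) (?d (v' - v))"
    by (simp add: linear_diff[OF linear_differential])
  also have "\<dots> = 0" using assms v' by (simp add: bilinear_lsub[OF ambient.metric_bilinear])
  finally have "gM q (v' - v) (v' - v) = 0" by (simp add: isometric)
  then show "v' = v" using sub.metric_pos[of "v' - v" q] by fastforce
qed

text \<open>Existence of the tangential part: the linear map \<open>L\<close> that represents the metric of the
  submanifold in the basis is injective by positivity, hence surjective, and so solves the
  orthogonality equations.\<close>

lemma tan_part_orthogonal:
  "g (\<iota> q) (w - differential B A \<iota> q (tan_part A g B \<iota> q w)) (differential B A \<iota> q u) = 0"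
proof -
  let ?d = "differential B A \<iota> q"
  define L where "L v = (\<Sum>b\<in>Basis. gM q v b *\<^sub>R b)" for v
  have bl: "bilinear (gM q)" by (rule sub.metric_bilinear)
  have lin: "linear L"
    by (rule linearI)
      (simp_all add: L_def bilinear_ladd[OF bl] bilinear_lmul[OF bl] algebra_simps sum.distrib scaleR_sum_right)
  have coord: "L v \<bullet> b = gM q v b" if "b \<in> Basis" for v b
    using that by (simp add: L_def inner_sum_left inner_Basis if_distrib cong: if_cong)
  have "v = 0" if "L v = 0" for v
  proof -
    have "gM q v b = 0" if "b \<in> Basis" for b using coord[OF that, of v] \<open>L v = 0\<close> by simp
    then have "gM q v v = 0"
      using linear_basis_expansion[of "gM q v" v] bl by (simp add: bilinear_def)
    then show ?thesis using sub.metric_pos[of v q] by fastforce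
  qed
  then have "inj L" using linear_injective_0[OF lin] by blast
  then have "surj L" using linear_injective_imp_surjective[OF lin] by blast
  then obtain v where v: "L v = (\<Sum>b\<in>Basis. g (\<iota> q) w (?d b) *\<^sub>R b)" by (metis surjD)
  have lg: "linear (\<lambda>u. g (\<iota> q) (w - ?d v) (?d u))"
    using linear_compose[OF linear_differential] ambient.metric_bilinear
    by (auto simp: bilinear_def o_def)
  have "g (\<iota> q) (w - ?d v) (?d b) = 0" if b: "b \<in> Basis" for b
  proof -
    have "gM q v b = g (\<iota> q) w (?d b)"
      using coord[OF b, of v] b unfolding v
      by (simp add: inner_sum_left inner_Basis if_distrib cong: if_cong)
    then show ?thesis by (simp add: isometric bilinear_lsub[OF ambient.metric_bilinear])
  qed
  then have orth: "g (\<iota> q) (w - ?d v) (?d u) = 0" for u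
    using linear_basis_expansion[OF lg, of u] by simp
  then show ?thesis using tan_part_unique[of q w v] by simp
qed

lemma tan_part_add:
  "tan_part A g B \<iota> q (w + w') = tan_part A g B \<iota> q w + tan_part A g B \<iota> q w'"
proof (rule tan_part_unique)
  fix u
  let ?d = "differential B A \<iota> q" and ?t = "tan_part A g B \<iota> q"
  have "w + w' - ?d (?t w + ?t w') = (w - ?d (?t w)) + (w' - ?d (?t w'))"
    by (simp add: linear_add[OF linear_differential])
  then show "g (\<iota> q) (w + w' - ?d (?t w + ?t w')) (?d u) = 0"
    by (simp only: bilinear_ladd[OF ambient.metric_bilinear] tan_part_orthogonal add_0_right)
qed

lemma nor_part_add:
  "nor_part A g B \<iota> q (w + w') = nor_part A g B \<iota> q w + nor_part A g B \<iota> q w'"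
  by (simp add: nor_part_def tan_part_add linear_add[OF linear_differential])

lemma tan_nor_decomposition:
  "differential B A \<iota> q (tan_part A g B \<iota> q w) + nor_part A g B \<iota> q w = w"
  by (simp add: nor_part_def)

section \<open>Extension of vector fields along an immersion\<close>

text \<open>In coordinates, the field along the immersion \<open>f\<close> is \<open>x \<mapsto> Df(x) (X x)\<close>. Substituting a smooth
  left inverse \<open>\<rho>\<close> of \<open>f\<close> for \<open>x\<close> extends it to a neighbourhood of \<open>\<iota> q\<close> in the ambient manifold.\<close>

lemma exists_extension_push_field:
  assumes X: "X \<in> vector_fields B"
  shows "\<exists>Z. extends_near A \<iota> (push_field A B \<iota> X) q Z"
proof -
  define b where "b = chart_at B q"
  define c where "c = chart_at A (\<iota> q)"
  have b: "b \<in> B" "q \<in> fst b" and c: "c \<in> A" "\<iota> q \<in> fst c"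
    by (auto simp: b_def c_def sub.chart_at ambient.chart_at)
  let ?f = "coord_map b c" and ?\<Omega> = "coord_domain b c"
  let ?w = "\<lambda>x. frechet_derivative ?f (at x) (field_in_chart B b X x)"
  have \<Omega>: "open ?\<Omega>" "snd b q \<in> ?\<Omega>" using open_coord_domain in_coord_domain b c by auto
  have f: "smooth_on ?\<Omega> ?f" using smooth_coord_map b c by blast
  have "inj (frechet_derivative ?f (at (snd b q)))"
    using immersion_inj[of q] by (simp add: differential_eq b_def c_def)
  then obtain \<rho> V U where V: "open V" and \<rho>: "smooth_on V \<rho>" "\<rho> ` V \<subseteq> ?\<Omega>"
    and U: "open U" "snd b q \<in> U" "U \<subseteq> ?\<Omega>" and inv: "\<And>x. x \<in> U \<Longrightarrow> ?f x \<in> V \<and> \<rho> (?f x) = x"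
    using smooth_local_left_inverse[OF \<Omega>(1) f \<Omega>(2)] by metis
  have "smooth_on (cimage b) (field_in_chart B b X)" using X b by (simp add: vector_fields_def)
  then have "smooth_on ?\<Omega> (field_in_chart B b X)"
    by (rule smooth_on_subset) (auto simp: coord_domain_def)
  then have w: "smooth_on ?\<Omega> ?w" by (rule smooth_on_derivative_apply[OF \<Omega>(1) f])
  let ?V = "V \<inter> cimage c"
  have oV: "open ?V" using V ambient.open_chart c by blast
  have "smooth_on ?V (\<lambda>y. ?w (\<rho> y))"
    by (rule smooth_on_compose[OF oV \<Omega>(1) smooth_on_subset[OF \<rho>(1)] w]) (use \<rho>(2) in auto)
  moreover have "snd c (\<iota> q) \<in> ?V"
    using inv[OF U(2)] coord_map_chart[OF b, of c] ambient.chart_in[OF c(2)] by simp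
  ultimately obtain W where W: "W \<in> vector_fields A"
      "\<forall>\<^sub>F m in nhds (\<iota> q). tcoord A c m (W m) = ?w (\<rho> (snd c m))"
    using ambient.exists_field_in_chart[OF c oV] by blast
  have "\<forall>\<^sub>F x in nhds (snd b q). x \<in> U" using U eventually_nhds by blast
  from sub.eventually_chart[OF b this] eventually_immersion[OF W(2)]
    eventually_immersion[OF eventually_nhds_in_open[OF ambient.open_chart(1)[OF c(1)] c(2)]]
  have "\<forall>\<^sub>F r in nhds q. W (\<iota> r) = push_field A B \<iota> X r"
  proof eventually_elim
    case (elim r)
    have r: "r \<in> fst b" using elim(1) by blast
    have "tcoord A c (\<iota> r) (W (\<iota> r)) = ?w (snd b r)"
      using elim(1,2) inv[of "snd b r"] coord_map_chart[OF b(1) r, of c] by simp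
    also have "\<dots> = tcoord A c (\<iota> r) (push_field A B \<iota> X r)"
      using tcoord_differential[OF b(1) c(1) r elim(3)] b r
      by (simp add: push_field_def field_in_chart_def sub.cinv_chart)
    finally show ?case by (rule ambient.tcoord_inject[OF c(1) elim(3)])
  qed
  then show ?thesis using W(1) unfolding extends_near_def by blast
qed

text \<open>The tangential part of an ambient field is extended by projecting within the ambient manifold:
  coordinate fields of the submanifold are extended to ambient fields \<open>E i\<close>, and \<open>V\<close> is projected
  orthogonally to their span. Along the immersion that span is the tangent space.\<close>

lemma exists_extension_tan_part:
  assumes V: "V \<in> vector_fields A"
  shows "\<exists>W. extends_near A \<iota> (push_field A B \<iota> (\<lambda>r. tan_part A g B \<iota> r (V (\<iota> r)))) q W"
proof -
  define b where "b = chart_at B q"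
  have b: "b \<in> B" "q \<in> fst b" by (auto simp: b_def sub.chart_at)
  have "\<exists>X\<in>vector_fields B. \<forall>\<^sub>F r in nhds q. tcoord B b r (X r) = i" for i
    using sub.exists_field_in_chart[OF b sub.open_chart(2)[OF b(1)] sub.chart_in[OF b(2)] subset_refl
        smooth_on_const[of _ i]] .
  then obtain X where X: "\<And>i. X i \<in> vector_fields B" "\<And>i. \<forall>\<^sub>F r in nhds q. tcoord B b r (X i r) = i"
    by metis
  have "\<exists>E. extends_near A \<iota> (push_field A B \<iota> (X i)) q E" for i
    by (rule exists_extension_push_field[OF X(1)])
  then obtain E where "\<And>i. extends_near A \<iota> (push_field A B \<iota> (X i)) q (E i)" by metis
  then have E: "\<And>i. E i \<in> vector_fields A"
      "\<And>i. \<forall>\<^sub>F r in nhds q. E i (\<iota> r) = differential B A \<iota> r (X i r)"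
    by (auto simp: extends_near_def push_field_def)
  have Eq: "E i (\<iota> q) = differential B A \<iota> q i" for i
    using eventually_nhds_x_imp_x[OF X(2)[of i]] eventually_nhds_x_imp_x[OF E(2)[of i]]
    by (simp add: b_def sub.tcoord_chart_at)
  interpret local_projection "\<iota> q" "{f. smooth_fun A f}" "vector_fields A" g
  proof
    show "(\<lambda>x. g x (Xa x) (Y x)) \<in> {f. smooth_fun A f}"
      if "Xa \<in> vector_fields A" "Y \<in> vector_fields A" for Xa Y
      using ambient.metric_smooth that by simp
    show "bilinear (g x)" for x by (rule ambient.metric_bilinear)
    show "g x u v = g x v u" for x u v by (rule ambient.metric_sym)
    show "0 < g x v v" if "v \<noteq> 0" for x v by (rule ambient.metric_pos[OF that])
  qed (simp_all add: ambient.smooth_fun_mult ambient.smooth_fun_local_inverse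
      ambient.vector_fields_zero ambient.vector_fields_add ambient.vector_fields_diff
      ambient.vector_fields_scale)
  have "inj_on (\<lambda>i. E i (\<iota> q)) Basis"
    unfolding Eq using immersion_inj inj_on_subset by blast
  moreover have "independent ((\<lambda>i. E i (\<iota> q)) ` Basis)"
    unfolding Eq using linear_independent_injective_image[OF linear_differential independent_Basis]
      immersion_inj inj_on_subset by blast
  ultimately obtain W where W: "W \<in> vector_fields A"
    and proj: "\<forall>\<^sub>F m in nhds (\<iota> q). W m \<in> span ((\<lambda>i. E i m) ` Basis) \<and>
        (\<forall>i\<in>Basis. g m (V m - W m) (E i m) = 0)"
    using exists_projection[OF finite_Basis, of E V] E(1) V by blast
  have "\<forall>\<^sub>F r in nhds q. \<forall>i\<in>Basis. E i (\<iota> r) = differential B A \<iota> r (X i r) \<and> tcoord B b r (X i r) = i"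
    using X(2) E(2) by (intro eventually_ball_finite ballI eventually_conj finite_Basis)
  moreover have "\<forall>\<^sub>F r in nhds q. r \<in> fst b"
    using sub.open_chart b eventually_nhds by blast
  ultimately have "\<forall>\<^sub>F r in nhds q.
      W (\<iota> r) = push_field A B \<iota> (\<lambda>r. tan_part A g B \<iota> r (V (\<iota> r))) r"
    using eventually_immersion[OF proj]
  proof eventually_elim
    case (elim r)
    let ?d = "differential B A \<iota> r"
    have "(\<lambda>i. E i (\<iota> r)) ` Basis = ?d ` ((\<lambda>i. X i r) ` Basis)"
      using elim(1) by force
    then have "W (\<iota> r) \<in> ?d ` span ((\<lambda>i. X i r) ` Basis)"
      using elim(3) linear_span_image[OF linear_differential] by metis
    then obtain v where v: "W (\<iota> r) = ?d v" by blast
    have "g (\<iota> r) (V (\<iota> r) - ?d v) (?d u) = 0" for u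
    proof -
      have "tcoord B b r u = tcoord B b r (\<Sum>i\<in>Basis. (tcoord B b r u \<bullet> i) *\<^sub>R X i r)"
        using elim(1)
        by (simp add: linear_sum[OF sub.tcoord_linear[OF b(1) elim(2)]]
            linear_cmul[OF sub.tcoord_linear[OF b(1) elim(2)]] euclidean_representation)
      then have u: "u = (\<Sum>i\<in>Basis. (tcoord B b r u \<bullet> i) *\<^sub>R X i r)"
        by (rule sub.tcoord_inject[OF b(1) elim(2)])
      have "?d u \<in> span ((\<lambda>i. E i (\<iota> r)) ` Basis)"
        unfolding arg_cong[OF u, of ?d] linear_sum[OF linear_differential] linear_cmul[OF linear_differential]
        by (intro span_sum span_scale span_base) (use elim(1) in force)
      then show ?thesis
        by (rule orthogonal_span[rotated]) (use elim(3) v in auto)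
    qed
    then have "tan_part A g B \<iota> r (V (\<iota> r)) = v" by (rule tan_part_unique)
    then show ?case using v by (simp add: push_field_def)
  qed
  then show ?thesis using W unfolding extends_near_def by blast
qed

end

section \<open>Structure equations of the tensor field along the immersion\<close>

theorem proposition3p1:
  fixes A :: "('m::{t2_space, second_countable_topology}, 'e::euclidean_space) chart set"
    and g :: "'m \<Rightarrow> 'e \<Rightarrow> 'e \<Rightarrow> real"
    and nab nab' :: "('m \<Rightarrow> 'e) \<Rightarrow> ('m \<Rightarrow> 'e) \<Rightarrow> 'm \<Rightarrow> 'e"
    and \<Theta> :: "'m \<Rightarrow> 'e \<Rightarrow> 'e"
    and B :: "('n::{t2_space, second_countable_topology}, 'd::euclidean_space) chart set"
    and gM :: "'n \<Rightarrow> 'd \<Rightarrow> 'd \<Rightarrow> real"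
    and \<iota> :: "'n \<Rightarrow> 'm"
    and X Y :: "'n \<Rightarrow> 'd"
  assumes "theta_statistical_manifold A g nab nab' \<Theta>"
    and "isometric_immersion B gM A g \<iota>"
    and "X \<in> vector_fields B" and "Y \<in> vector_fields B"
  shows "(\<forall>q. induced_conn A g B \<iota> nab X (P_part A g B \<iota> \<Theta> Y) q
              - shape_op A g B \<iota> nab (F_part A g B \<iota> \<Theta> Y) X q
            = P_part A g B \<iota> \<Theta> (induced_conn A g B \<iota> nab' X Y) q
              + t_part A g B \<iota> \<Theta> (second_form A g B \<iota> nab' X Y) q)
       \<and> (\<forall>q. second_form A g B \<iota> nab X (P_part A g B \<iota> \<Theta> Y) q
              + normal_conn A g B \<iota> nab X (F_part A g B \<iota> \<Theta> Y) q
            = F_part A g B \<iota> \<Theta> (induced_conn A g B \<iota> nab' X Y) q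
              + f_part A g B \<iota> \<Theta> (second_form A g B \<iota> nab' X Y) q)"
proof -
  interpret theta_statistical_manifold A g nab nab' \<Theta> by fact
  interpret imm: isometric_immersion B gM A g \<iota> by fact
  let ?P = "P_part A g B \<iota> \<Theta>" and ?F = "F_part A g B \<iota> \<Theta>"
  let ?push = "push_field A B \<iota>" and ?along = "conn_along A B \<iota>"
  let ?tan = "tan_part A g B \<iota>" and ?nor = "nor_part A g B \<iota>"
  \<comment> \<open>The gauge equation along the immersion, before it is split into tangential and normal
      parts.\<close>
  have gauge_along: "?along nab X (?push (?P Y)) q + ?along nab X (?F Y) q
      = \<Theta> (\<iota> q) (?along nab' X (?push Y) q)" for q
  proof -
    obtain Z where Z: "extends_near A \<iota> (?push X) q Z"
      using imm.exists_extension_push_field[OF \<open>X \<in> vector_fields B\<close>] by blast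
    obtain W where W: "extends_near A \<iota> (?push Y) q W"
      using imm.exists_extension_push_field[OF \<open>Y \<in> vector_fields B\<close>] by blast
    define TW where "TW m = \<Theta> m (W m)" for m
    have vf: "Z \<in> vector_fields A" "W \<in> vector_fields A"
      using Z W by (auto simp: extends_near_def)
    have TW: "TW \<in> vector_fields A" using theta_smooth[OF vf(2)] by (simp add: TW_def[abs_def])
    obtain W1 where W1: "extends_near A \<iota> (?push (\<lambda>r. ?tan r (TW (\<iota> r)))) q W1"
      using imm.exists_extension_tan_part[OF TW] by blast
    have "\<forall>\<^sub>F r in nhds q. W (\<iota> r) = ?push Y r" using W by (simp add: extends_near_def)
    moreover have "\<forall>\<^sub>F r in nhds q. W1 (\<iota> r) = ?push (\<lambda>r. ?tan r (TW (\<iota> r))) r"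
      using W1 by (simp add: extends_near_def)
    ultimately have ev: "\<forall>\<^sub>F r in nhds q. W1 (\<iota> r) = ?push (?P Y) r \<and> TW (\<iota> r) - W1 (\<iota> r) = ?F Y r"
      by eventually_elim (simp add: TW_def P_part_def F_part_def nor_part_def push_field_def)
    have W1vf: "W1 \<in> vector_fields A" using W1 by (simp add: extends_near_def)
    have W1P: "extends_near A \<iota> (?push (?P Y)) q W1"
      using ev W1vf by (auto simp: extends_near_def elim: eventually_mono)
    have W2vf: "(\<lambda>m. TW m - W1 m) \<in> vector_fields A" by (rule vector_fields_diff[OF TW W1vf])
    have W2F: "extends_near A \<iota> (?F Y) q (\<lambda>m. TW m - W1 m)"
      using ev W2vf by (auto simp: extends_near_def elim: eventually_mono)
    have "?along nab X (?push (?P Y)) q + ?along nab X (?F Y) q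
        = nab Z W1 (\<iota> q) + nab Z (\<lambda>m. TW m - W1 m) (\<iota> q)"
      using imm.conn_along_eq[OF conn.affine_connection_axioms Z W1P]
        imm.conn_along_eq[OF conn.affine_connection_axioms Z W2F] by simp
    also have "\<dots> = nab Z TW (\<iota> q)"
      using conn.conn_add_right[OF vf(1) W1vf W2vf] by simp
    also have "\<dots> = \<Theta> (\<iota> q) (nab' Z W (\<iota> q))"
      using gauge[OF vf] by (simp add: TW_def[abs_def])
    also have "nab' Z W (\<iota> q) = ?along nab' X (?push Y) q"
      using imm.conn_along_eq[OF dual.affine_connection_axioms Z W] by simp
    finally show ?thesis .
  qed
  \<comment> \<open>The right-hand sides of both equations arise from splitting the argument of \<open>\<Theta>\<close>.\<close>
  have split: "\<Theta> (\<iota> q) w = \<Theta> (\<iota> q) (differential B A \<iota> q (?tan q w)) + \<Theta> (\<iota> q) (?nor q w)" for q w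
    using linear_add[OF theta_linear, of "\<iota> q"] imm.tan_nor_decomposition by metis
  have tan: "?tan q (?along nab X (?push (?P Y)) q) + ?tan q (?along nab X (?F Y) q)
      = ?tan q (\<Theta> (\<iota> q) (differential B A \<iota> q (?tan q (?along nab' X (?push Y) q))))
        + ?tan q (\<Theta> (\<iota> q) (?nor q (?along nab' X (?push Y) q)))" for q
    using gauge_along[of q] split[of q "?along nab' X (?push Y) q"] imm.tan_part_add[of q] by metis
  have nor: "?nor q (?along nab X (?push (?P Y)) q) + ?nor q (?along nab X (?F Y) q)
      = ?nor q (\<Theta> (\<iota> q) (differential B A \<iota> q (?tan q (?along nab' X (?push Y) q))))
        + ?nor q (\<Theta> (\<iota> q) (?nor q (?along nab' X (?push Y) q)))" for q
    using gauge_along[of q] split[of q "?along nab' X (?push Y) q"] imm.nor_part_add[of q] by metis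
  have P: "?P V q = ?tan q (\<Theta> (\<iota> q) (differential B A \<iota> q (V q)))"
    and F: "?F V q = ?nor q (\<Theta> (\<iota> q) (differential B A \<iota> q (V q)))" for V q
    by (simp_all add: P_part_def F_part_def push_field_def)
  show ?thesis
    using tan nor
    by (simp add: P F induced_conn_def shape_op_def second_form_def normal_conn_def t_part_def f_part_def)
qed

end
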